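(* There exists a universal constant $C>0$ such that for every weighted finite graph $G$ (as in the context) with $N$ vertices and every natural number $1\leq k\leq N$, \[ \frac{2-\lambda_{N-k+1}}{2}\;\leq\; 1-\overline{h}(k)\;\leq\; Ck^3\sqrt{2-\lambda_{N-k+1}}, \] or equivalently \[ \frac{1}{C^2k^6}\bigl(1-\overline{h}(k)\bigr)^2\;\leq\; 2-\lambda_{N-k+1}\;\leq\; 2\bigl(1-\overline{h}(k)\bigr). \]
   Context: $G=(V,E,w)$ is a finite undirected graph without self-loops, with $N=|V|$ vertices; each edge $\{u,v\}\in E$ carries a positive symmetric weight $w_{uv}=w_{vu}$, and $w_{uv}=0$ if $\{u,v\}\notin E$. The degree is $d_u=\sum_{v}w_{uv}$ (implicitly positive for every vertex), and $\mu(u)=d_u$. For $A,B\subseteq V$, $|E(A,B)|:=\sum_{u\in A,v\in B}w_{uv}$ and $\mathrm{vol}(A):=\sum_{u\in A}d_u$. The normalized Laplacian is $\Delta f(u)=\frac{1}{d_u}\sum_{v}w_{uv}(f(u)-f(v))$ for $f:V\to\mathbb{R}$; it is self-adjoint for $(f,g)_\mu=\sum_u\mu(u)f(u)g(u)$, and its eigenvalues, listed with multiplicity, are $0=\lambda_1\leq\lambda_2\leq\cdots\leq\lambda_N\leq 2$. For disjoint $V_1,V_2\subseteq V$ with $V_1\cup V_2\neq\emptyset$, $\overline{\phi}(V_1,V_2):=\frac{2|E(V_1,V_2)|}{\mathrm{vol}(V_1\cup V_2)}$. A $k$-sub-bipartition is a collection of $k$ pairs $(V_1,V_2),\ldots,(V_{2k-1},V_{2k})$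 of subsets of $V$ with $V_p\cap V_q=\emptyset$ for all $1\leq p\neq q\leq 2k$ and $V_{2i-1}\cup V_{2i}\neq\emptyset$ for each $i$ (individual sets may be empty). The $k$-way dual Cheeger constant is $\overline{h}(k):=\max\min_{1\leq i\leq k}\overline{\phi}(V_{2i-1},V_{2i})$, the maximum over all $k$-sub-bipartitions. *)

theory Defs
  imports "Jordan_Normal_Form.Char_Poly" "HOL-Library.Multiset"
begin

definition wgraph :: "nat \<Rightarrow> (nat \<Rightarrow> nat \<Rightarrow> real) \<Rightarrow> bool" where
  "wgraph N w \<longleftrightarrow>
     (\<forall>u<N. \<forall>v<N. w u v = w v u) \<and>
     (\<forall>u<N. \<forall>v<N. w u v \<ge> 0) \<and>
     (\<forall>u<N. w u u = 0) \<and>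
     (\<forall>u<N. (\<Sum>v<N. w u v) > 0)"

definition deg :: "nat \<Rightarrow> (nat \<Rightarrow> nat \<Rightarrow> real) \<Rightarrow> nat \<Rightarrow> real" where
  "deg N w u = (\<Sum>v<N. w u v)"

definition edges_between :: "(nat \<Rightarrow> nat \<Rightarrow> real) \<Rightarrow> nat set \<Rightarrow> nat set \<Rightarrow> real" where
  "edges_between w A B = (\<Sum>u\<in>A. \<Sum>v\<in>B. w u v)"

definition vol :: "nat \<Rightarrow> (nat \<Rightarrow> nat \<Rightarrow> real) \<Rightarrow> nat set \<Rightarrow> real" where
  "vol N w A = (\<Sum>u\<in>A. deg N w u)"

definition bip_ratio :: "nat \<Rightarrow> (nat \<Rightarrow> nat \<Rightarrow> real) \<Rightarrow> nat set \<Rightarrow> nat set \<Rightarrow> real" where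
  "bip_ratio N w A B = 2 * edges_between w A B / vol N w (A \<union> B)"

definition norm_laplacian :: "nat \<Rightarrow> (nat \<Rightarrow> nat \<Rightarrow> real) \<Rightarrow> real mat" where
  "norm_laplacian N w = mat N N (\<lambda>(u,v). (if u = v then 1 else 0) - w u v / deg N w u)"

text \<open>j-th smallest eigenvalue (1-based, with multiplicity): roots of the characteristic polynomial.\<close>
definition lap_eig :: "nat \<Rightarrow> (nat \<Rightarrow> nat \<Rightarrow> real) \<Rightarrow> nat \<Rightarrow> real" where
  "lap_eig N w j = sorted_list_of_multiset (proots (char_poly (norm_laplacian N w))) ! (j - 1)"

text \<open>k-sub-bipartition: sets S 0, ..., S (2k-1); pairs (S(2i), S(2i+1)), i < k.\<close>
definition sub_bipartition :: "nat \<Rightarrow> nat \<Rightarrow> (nat \<Rightarrow> nat set) \<Rightarrow> bool" where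
  "sub_bipartition N k S \<longleftrightarrow>
     (\<forall>p<2*k. S p \<subseteq> {..<N}) \<and>
     (\<forall>p<2*k. \<forall>q<2*k. p \<noteq> q \<longrightarrow> S p \<inter> S q = {}) \<and>
     (\<forall>i<k. S (2*i) \<union> S (2*i+1) \<noteq> {})"

definition dual_cheeger :: "nat \<Rightarrow> (nat \<Rightarrow> nat \<Rightarrow> real) \<Rightarrow> nat \<Rightarrow> real" where
  "dual_cheeger N w k = Max {Min ((\<lambda>i. bip_ratio N w (S (2*i)) (S (2*i+1))) ` {..<k}) | S.
                               sub_bipartition N k S}"

end

theory Submission
  imports "HOL-Analysis.Henstock_Kurzweil_Integration" "HOL-Analysis.L2_Norm"
    "HOL-Analysis.Function_Topology" Defs
begin

text \<open>
  Write \<open>\<eta>\<close> for the \<open>k\<close>-th smallest eigenvalue of \<open>2 - \<Delta>\<close>. The left inequality is the min-max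
  principle applied to the span of the functions \<open>1\<close> on \<open>V\<^sub>2\<^sub>i\<^sub>-\<^sub>1\<close>, \<open>-1\<close> on \<open>V\<^sub>2\<^sub>i\<close>.

  For the right one, \<open>k\<close> orthonormal eigenfunctions embed the vertices into \<open>k\<close>-dimensional space
  by a map \<open>F\<close> with small energy \<open>\<Sum> w\<^sub>u\<^sub>v \<parallel>F u + F v\<parallel>\<^sup>2\<close>. The directions \<open>F v / \<parallel>F v\<parallel>\<close> are sorted
  into the cells of a cubical grid of mesh \<open>1 / (4 k)\<close> that is symmetric about the origin and randomly shifted,
  opposite cells being identified. Orthonormality makes the embedding isotropic, so a cell carries
  mass at most \<open>1 + 1 / (2 k)\<close> of the total mass \<open>k\<close>, and cells can be merged into \<open>k\<close> regions of mass at
  least \<open>1/2\<close>; the two opposite halves of a region form a pair. Truncating a region at a random level of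
  \<open>\<parallel>F\<parallel>\<^sup>2\<close>, the expected weight of the edges that do not join opposite halves is
  \<open>O(k\<^sup>2) \<Sum> w\<^sub>u\<^sub>v \<parallel>F u\<parallel> \<parallel>F u + F v\<parallel>\<close>, which is \<open>O(k\<^sup>3 \<surd>\<eta>)\<close> by Cauchy-Schwarz.
\<close>

section \<open>Simultaneous diagonalization of quadratic forms\<close>

definition wip :: "nat \<Rightarrow> (nat \<Rightarrow> real) \<Rightarrow> (nat \<Rightarrow> real) \<Rightarrow> (nat \<Rightarrow> real) \<Rightarrow> real" where
  "wip n d f g = (\<Sum>v<n. d v * f v * g v)"

definition bform :: "nat \<Rightarrow> (nat \<Rightarrow> nat \<Rightarrow> real) \<Rightarrow> (nat \<Rightarrow> real) \<Rightarrow> (nat \<Rightarrow> real) \<Rightarrow> real" where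
  "bform n a f g = (\<Sum>u<n. \<Sum>v<n. a u v * f u * g v)"

text \<open>Fewer equations than unknowns: padding the coefficients with zero rows gives a square
  matrix, whose row \<open>m\<close> vanishes, so its determinant is 0 and its kernel is
  nontrivial.\<close>

lemma homogeneous_system_nontrivial:
  fixes c :: "nat \<Rightarrow> nat \<Rightarrow> real"
  assumes "m < n"
  obtains x where "\<exists>v<n. x v \<noteq> 0" "\<And>i. i < m \<Longrightarrow> (\<Sum>v<n. c i v * x v) = 0"
proof -
  define M where "M = Matrix.mat n n (\<lambda>(i,v). if i < m then c i v else 0)"
  have M: "M \<in> carrier_mat n n" by (simp add: M_def)
  have eq: "M = mat\<^sub>r n n (\<lambda>i. if i = m then 0\<^sub>v n else Matrix.row M i)"
    by (intro eq_matI) (auto simp: M_def)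
  have "Determinant.det M = 0"
    by (subst eq, rule det_row_0[OF assms]) (use M in auto)
  then obtain y where y: "y \<in> carrier_vec n" "y \<noteq> 0\<^sub>v n" "M *\<^sub>v y = 0\<^sub>v n"
    using det_0_iff_vec_prod_zero[OF M] by blast
  show thesis
  proof (rule that[of "vec_index y"])
    have "y = 0\<^sub>v n" if "\<forall>v<n. vec_index y v = 0"
      using y(1) that by (intro eq_vecI) auto
    then show "\<exists>v<n. vec_index y v \<noteq> 0" using y(2) by blast
    fix i assume i: "i < m"
    have "vec_index (M *\<^sub>v y) i = 0" using y(3) i assms by simp
    then show "(\<Sum>v<n. c i v * vec_index y v) = 0"
      using i assms y(1) M by (simp add: M_def scalar_prod_def lessThan_atLeast0)
  qed
qed

lemma wip_commute: "wip n d f g = wip n d g f"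
  by (simp add: wip_def mult_ac)

lemma wip_add_left: "wip n d (\<lambda>v. f v + g v) h = wip n d f h + wip n d g h"
  by (simp add: wip_def algebra_simps sum.distrib)

lemma wip_scale_left: "wip n d (\<lambda>v. c * f v) h = c * wip n d f h"
  by (simp add: wip_def sum_distrib_left mult_ac)

lemma wip_sum_left: "wip n d (\<lambda>v. \<Sum>i\<in>I. f i v) h = (\<Sum>i\<in>I. wip n d (f i) h)"
  unfolding wip_def sum_distrib_left sum_distrib_right by (rule sum.swap)

lemma bform_commute:
  assumes "\<And>u v. u < n \<Longrightarrow> v < n \<Longrightarrow> a u v = a v u"
  shows "bform n a f g = bform n a g f"
proof -
  have "a u v * f u * g v = a v u * g v * f u" if "u < n" "v < n" for u v
    using assms[OF that] by simp
  then show ?thesis unfolding bform_def by (subst sum.swap) (intro sum.cong refl, simp)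
qed

lemma bform_add_left: "bform n a (\<lambda>v. f v + g v) h = bform n a f h + bform n a g h"
  by (simp add: bform_def algebra_simps sum.distrib)

lemma bform_scale_left: "bform n a (\<lambda>v. c * f v) h = c * bform n a f h"
  by (simp add: bform_def sum_distrib_left mult_ac)

lemma bform_sum_left: "bform n a (\<lambda>v. \<Sum>i\<in>I. f i v) h = (\<Sum>i\<in>I. bform n a (f i) h)"
proof -
  have "bform n a (\<lambda>v. \<Sum>i\<in>I. f i v) h = (\<Sum>u<n. \<Sum>i\<in>I. \<Sum>v<n. a u v * f i u * h v)"
    unfolding bform_def sum_distrib_left sum_distrib_right by (intro sum.cong refl sum.swap)
  also have "\<dots> = (\<Sum>i\<in>I. bform n a (f i) h)"
    unfolding bform_def by (rule sum.swap)
  finally show ?thesis .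
qed

lemma wip_nonneg: "(\<And>v. v < n \<Longrightarrow> d v > 0) \<Longrightarrow> wip n d f f \<ge> 0"
  by (auto simp: wip_def mult.assoc less_imp_le intro!: sum_nonneg)

lemma wip_eq_0_iff:
  assumes "\<And>v. v < n \<Longrightarrow> d v > 0"
  shows "wip n d f f = 0 \<longleftrightarrow> (\<forall>v<n. f v = 0)"
proof -
  have "wip n d f f = 0 \<longleftrightarrow> (\<forall>v\<in>{..<n}. d v * f v * f v = 0)"
    unfolding wip_def using assms
    by (intro sum_nonneg_eq_0_iff) (auto simp: mult.assoc less_imp_le)
  also have "\<dots> \<longleftrightarrow> (\<forall>v<n. f v = 0)" using assms by (auto simp: less_le)
  finally show ?thesis .
qed

lemma continuous_wip: "continuous_on UNIV (\<lambda>f. wip n d f g)"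
  unfolding wip_def by (intro continuous_on_sum continuous_on_mult continuous_on_const continuous_on_product_coordinates)

lemma continuous_wip_diag: "continuous_on UNIV (\<lambda>f. wip n d f f)"
  unfolding wip_def by (intro continuous_on_sum continuous_on_mult continuous_on_const continuous_on_product_coordinates)

lemma continuous_bform_diag: "continuous_on UNIV (\<lambda>f. bform n a f f)"
  unfolding bform_def by (intro continuous_on_sum continuous_on_mult continuous_on_const continuous_on_product_coordinates)

text \<open>The Rayleigh quotient attains its minimum on the orthogonal complement of the
  \<open>G i\<close>, because the unit sphere there is compact; \<open>m < n\<close> makes that
  sphere nonempty.\<close>

lemma bform_minimizer_exists:
  assumes d: "\<And>v. v < n \<Longrightarrow> d v > 0" and "m < n"
  shows "\<exists>g. wip n d g g = 1 \<and> (\<forall>i<m. wip n d g (G i) = 0) \<and>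
    (\<forall>f. (\<forall>i<m. wip n d f (G i) = 0) \<longrightarrow> bform n a g g * wip n d f f \<le> bform n a f f)"
proof -
  \<comment> \<open>On the unit sphere coordinate \<open>v\<close> is at most
    \<open>1 / sqrt (d v)\<close> in absolute value. Coordinates from \<open>n\<close> on are pinned
    to 0, so that \<open>K\<close> is a product of compact intervals, compact by Tychonoff.\<close>
  define c where "c v = (if v < n then 1 / sqrt (d v) else 0)" for v
  define K where "K = (\<Pi>\<^sub>E v\<in>UNIV. {- c v..c v})"
  define S where "S = K \<inter> {f. wip n d f f = 1} \<inter> (\<Inter>i\<in>{..<m}. {f. wip n d f (G i) = 0})"
  have "compactin (product_topology (\<lambda>_. euclidean) UNIV) K"
    unfolding K_def by (subst compactin_PiE) (auto simp: compactin_euclidean_iff)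
  then have "compact K" by (simp add: euclidean_product_topology compactin_euclidean_iff)
  moreover have "closed {f. wip n d f f = 1}"
    by (intro closed_Collect_eq continuous_wip_diag continuous_on_const)
  moreover have "closed {f. wip n d f (G i) = 0}" for i
    by (intro closed_Collect_eq continuous_wip continuous_on_const)
  ultimately have "compact S" unfolding S_def by (intro compact_Int_closed closed_INT) auto
  have normalize: "\<exists>h\<in>S. (\<forall>v<n. h v = f v / sqrt (wip n d f f))"
    if f: "\<And>i. i < m \<Longrightarrow> wip n d f (G i) = 0" "wip n d f f \<noteq> 0" for f
  proof -
    have pos: "wip n d f f > 0" using f(2) wip_nonneg[of n d f] d by force
    define h where "h v = (if v < n then 1 / sqrt (wip n d f f) * f v else 0)" for v
    have eq: "wip n d h g = 1 / sqrt (wip n d f f) * wip n d f g" for g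
      unfolding wip_scale_left[symmetric] by (simp add: wip_def h_def)
    have "wip n d h h = 1 / sqrt (wip n d f f) * (1 / sqrt (wip n d f f) * wip n d f f)"
      by (subst eq, subst wip_commute, subst eq) simp
    then have h1: "wip n d h h = 1" using pos by (simp add: field_simps)
    have "h \<in> K" unfolding K_def
    proof (rule PiE_I)
      fix v
      show "h v \<in> {- c v..c v}"
      proof (cases "v < n")
        case True
        have "d v * h v * h v \<le> wip n d h h" unfolding wip_def
          using d True by (intro member_le_sum) (auto simp: mult.assoc less_imp_le)
        then have "(h v)\<^sup>2 \<le> 1 / d v"
          using d[OF True] h1 by (simp add: field_simps power2_eq_square)
        then have "\<bar>h v\<bar> \<le> sqrt (1 / d v)" using real_le_rsqrt by (metis real_sqrt_abs real_sqrt_le_iff)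
        then show ?thesis using True by (auto simp: c_def real_sqrt_divide)
      qed (simp add: h_def c_def)
    qed simp
    then have "h \<in> S" using h1 f(1) eq by (auto simp: S_def)
    then show ?thesis by (intro bexI[of _ h]) (simp_all add: h_def)
  qed
  obtain x where x: "\<exists>v<n. x v \<noteq> 0" "\<And>i. i < m \<Longrightarrow> (\<Sum>v<n. (d v * G i v) * x v) = 0"
    by (rule homogeneous_system_nontrivial[OF \<open>m < n\<close>, of "\<lambda>i v. d v * G i v"]) (rule that)
  have "wip n d x x \<noteq> 0" using x(1) wip_eq_0_iff[of n d x] d by blast
  moreover have "wip n d x (G i) = 0" if "i < m" for i
    using x(2)[OF that] by (simp add: wip_def mult_ac)
  ultimately have "S \<noteq> {}" using normalize by blast
  then obtain g where g: "g \<in> S" "\<And>f. f \<in> S \<Longrightarrow> bform n a g g \<le> bform n a f f"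
    using continuous_attains_inf[OF \<open>compact S\<close> _ continuous_on_subset[OF continuous_bform_diag]]
    by (metis subset_UNIV)
  show ?thesis
  proof (intro exI[of _ g] conjI allI impI)
    show "wip n d g g = 1" using g(1) by (simp add: S_def)
    show "wip n d g (G i) = 0" if "i < m" for i using g(1) that by (auto simp: S_def)
    fix f assume f: "\<forall>i<m. wip n d f (G i) = 0"
    show "bform n a g g * wip n d f f \<le> bform n a f f"
    proof (cases "wip n d f f = 0")
      case True
      then have "\<forall>v<n. f v = 0" using wip_eq_0_iff[of n d f] d by blast
      then show ?thesis using True by (simp add: bform_def)
    next
      case False
      then obtain h where h: "h \<in> S" "\<forall>v<n. h v = f v / sqrt (wip n d f f)"
        using normalize f by blast
      have pos: "wip n d f f > 0" using False wip_nonneg[of n d f] d by force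
      have "bform n a h h = bform n a f f / wip n d f f"
        using h(2) pos by (simp add: bform_def sum_divide_distrib real_sqrt_mult[symmetric])
      then show ?thesis using g(2)[OF h(1)] pos by (simp add: pos_le_divide_eq)
    qed
  qed
qed

lemma linear_coefficient_eq_0:
  fixes b c :: real
  assumes "\<And>e. 0 \<le> 2 * e * b + e\<^sup>2 * c"
  shows "b = 0"
proof (rule ccontr)
  assume b: "b \<noteq> 0"
  \<comment> \<open>For this \<open>e\<close> the linear term outweighs the quadratic one; the added
    1 keeps the denominator nonzero when \<open>c = 0\<close>.\<close>
  have "0 \<le> 2 * (- b / (\<bar>c\<bar> + 1)) * b + (- b / (\<bar>c\<bar> + 1))\<^sup>2 * c" by (rule assms)
  also have "\<dots> = b\<^sup>2 / (\<bar>c\<bar> + 1)\<^sup>2 * (c - 2 * (\<bar>c\<bar> + 1))"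
  proof -
    have "\<bar>c\<bar> + 1 \<noteq> 0" by linarith
    then show ?thesis by (simp add: divide_simps power2_eq_square) (simp add: algebra_simps)
  qed
  also have "\<dots> < 0" using b by (intro mult_pos_neg) auto
  finally show False by simp
qed

text \<open>First variation: \<open>g + e * h\<close> is admissible for every \<open>e\<close>, and
  the excess of its form over \<open>l\<close> times its squared norm is a nonnegative quadratic in
  \<open>e\<close> without constant term, so its linear coefficient vanishes.\<close>

lemma bform_minimizer_stationary:
  assumes sym: "\<And>u v. u < n \<Longrightarrow> v < n \<Longrightarrow> a u v = a v u"
    and g: "wip n d g g = 1" "\<forall>i<m. wip n d g (G i) = 0"
    and min: "\<forall>f. (\<forall>i<m. wip n d f (G i) = 0) \<longrightarrow> bform n a g g * wip n d f f \<le> bform n a f f"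
    and h: "\<forall>i<m. wip n d h (G i) = 0"
  shows "bform n a h g = bform n a g g * wip n d h g"
proof -
  define l where "l = bform n a g g"
  have "0 \<le> 2 * e * (bform n a h g - l * wip n d h g) + e\<^sup>2 * (bform n a h h - l * wip n d h h)" for e
  proof -
    let ?f = "\<lambda>v. g v + e * h v"
    have "wip n d ?f ?f = 1 + 2 * e * wip n d h g + e\<^sup>2 * wip n d h h"
      by (simp add: wip_add_left wip_scale_left wip_commute[of n d _ ?f] g(1) wip_commute[of n d g h]
          power2_eq_square algebra_simps)
    moreover have "bform n a ?f ?f = l + 2 * e * bform n a h g + e\<^sup>2 * bform n a h h"
      by (simp add: bform_add_left bform_scale_left bform_commute[of n a _ ?f, OF sym] l_def
          bform_commute[of n a g h, OF sym] power2_eq_square algebra_simps)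
    moreover have "l * wip n d ?f ?f \<le> bform n a ?f ?f"
      unfolding l_def by (intro min[rule_format]) (simp add: wip_add_left wip_scale_left g(2) h)
    ultimately show ?thesis by (simp add: algebra_simps)
  qed
  then have "bform n a h g - l * wip n d h g = 0" by (rule linear_coefficient_eq_0)
  then show ?thesis by (simp add: l_def)
qed

lemma simultaneous_diagonalization_aux:
  assumes sym: "\<And>u v. u < n \<Longrightarrow> v < n \<Longrightarrow> a u v = a v u"
    and d: "\<And>v. v < n \<Longrightarrow> d v > 0" and "m \<le> n"
  shows "\<exists>g \<eta>. (\<forall>i<m. \<forall>j<m. wip n d (g i) (g j) = (if i = j then 1 else 0)) \<and>
    (\<forall>i<m. \<forall>h. bform n a h (g i) = \<eta> i * wip n d h (g i)) \<and>
    (\<forall>i<m. \<forall>f. (\<forall>j<i. wip n d f (g j) = 0) \<longrightarrow> \<eta> i * wip n d f f \<le> bform n a f f)"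
  using \<open>m \<le> n\<close>
proof (induction m)
  case (Suc m)
  obtain G \<eta> where IH: "\<forall>i<m. \<forall>j<m. wip n d (G i) (G j) = (if i = j then 1 else 0)"
    "\<forall>i<m. \<forall>h. bform n a h (G i) = \<eta> i * wip n d h (G i)"
    "\<forall>i<m. \<forall>f. (\<forall>j<i. wip n d f (G j) = 0) \<longrightarrow> \<eta> i * wip n d f f \<le> bform n a f f"
    using Suc.IH[OF Suc_leD[OF Suc.prems]] by blast
  note orth = IH(1)[rule_format] and eig = IH(2)[rule_format] and mini = IH(3)[rule_format]
  obtain g where *: "wip n d g g = 1" "\<forall>i<m. wip n d g (G i) = 0"
    "\<forall>f. (\<forall>i<m. wip n d f (G i) = 0) \<longrightarrow> bform n a g g * wip n d f f \<le> bform n a f f"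
    using bform_minimizer_exists[of n d m G a, OF d Suc_le_lessD[OF Suc.prems]] by blast
  note g = *(1) *(2)[rule_format] and gmin = *(3)[rule_format]
  define l where "l = bform n a g g"
  have geig: "bform n a h g = l * wip n d h g" for h
  proof -
    \<comment> \<open>Stationarity covers only directions orthogonal to the earlier
      \<open>G i\<close>. A general \<open>h\<close> differs from such a \<open>q\<close> by its
      projection \<open>p\<close> onto their span, and both forms of \<open>p\<close> against
      \<open>g\<close> vanish because the \<open>G i\<close> are eigenfunctions orthogonal to
      \<open>g\<close>.\<close>
    define p where "p = (\<lambda>v. \<Sum>i<m. wip n d h (G i) * G i v)"
    define q where "q = (\<lambda>v. h v + (-1) * p v)"
    have "wip n d p (G j) = wip n d h (G j)" if "j < m" for j
      using that by (simp add: p_def wip_sum_left wip_scale_left orth if_distrib sum.delta cong: if_cong)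
    then have "\<forall>j<m. wip n d q (G j) = 0"
      unfolding q_def wip_add_left wip_scale_left by simp
    then have "bform n a q g = l * wip n d q g"
      unfolding l_def by (intro bform_minimizer_stationary[OF _ *]) (auto intro: sym)
    moreover have "bform n a p g = 0"
      using g(2) by (simp add: p_def bform_sum_left bform_scale_left bform_commute[of n a _ g, OF sym] eig)
    moreover have "wip n d p g = 0"
      using g(2) by (simp add: p_def wip_sum_left wip_scale_left wip_commute[of n d _ g])
    ultimately show ?thesis unfolding q_def bform_add_left bform_scale_left wip_add_left wip_scale_left by simp
  qed
  show ?case
  proof (intro exI[of _ "G(m := g)"] exI[of _ "\<eta>(m := l)"] conjI allI impI)
    fix i j assume "i < Suc m" "j < Suc m"
    moreover have "wip n d (G i) g = 0" if "i < m" for i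
      using g(2)[OF that] by (simp add: wip_commute)
    ultimately show "wip n d ((G(m := g)) i) ((G(m := g)) j) = (if i = j then 1 else 0)"
      using orth g by (auto simp: less_Suc_eq)
  next
    fix i h assume "i < Suc m"
    then show "bform n a h ((G(m := g)) i) = (\<eta>(m := l)) i * wip n d h ((G(m := g)) i)"
      using eig geig by (auto simp: less_Suc_eq)
  next
    fix i f assume "i < Suc m" "\<forall>j<i. wip n d f ((G(m := g)) j) = 0"
    then show "(\<eta>(m := l)) i * wip n d f f \<le> bform n a f f"
      using mini[of i f] gmin[of f] by (auto simp: less_Suc_eq l_def)
  qed
qed simp

lemma simultaneous_diagonalization:
  assumes sym: "\<And>u v. u < n \<Longrightarrow> v < n \<Longrightarrow> a u v = a v u"
    and d: "\<And>v. v < n \<Longrightarrow> d v > 0"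
  shows "\<exists>g \<eta>. (\<forall>i<n. \<forall>j<n. wip n d (g i) (g j) = (if i = j then 1 else 0)) \<and>
    (\<forall>i<n. \<forall>h. bform n a h (g i) = \<eta> i * wip n d h (g i)) \<and>
    (\<forall>i<n. \<forall>f. (\<forall>j<i. wip n d f (g j) = 0) \<longrightarrow> \<eta> i * wip n d f f \<le> bform n a f f) \<and>
    (\<forall>j<n. \<forall>i\<le>j. \<eta> i \<le> \<eta> j)"
proof -
  obtain g \<eta> where *: "\<forall>i<n. \<forall>j<n. wip n d (g i) (g j) = (if i = j then 1 else 0)"
    "\<forall>i<n. \<forall>h. bform n a h (g i) = \<eta> i * wip n d h (g i)"
    "\<forall>i<n. \<forall>f. (\<forall>j<i. wip n d f (g j) = 0) \<longrightarrow> \<eta> i * wip n d f f \<le> bform n a f f"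
    using simultaneous_diagonalization_aux[of n a d n, OF sym d order_refl] by blast
  \<comment> \<open>For \<open>i \<le> j\<close> the function \<open>g j\<close> is orthogonal to
    all \<open>g\<close> before \<open>i\<close>, hence a competitor in the minimum problem defining
    \<open>\<eta> i\<close>.\<close>
  have "\<eta> i \<le> \<eta> j" if "i \<le> j" "j < n" for i j
    using *(3)[rule_format, of i "g j"] that *(1) *(2)[rule_format, of j "g j"] by auto
  then have "\<forall>j<n. \<forall>i\<le>j. \<eta> i \<le> \<eta> j" by simp
  with * show ?thesis by (intro exI[of _ g] exI[of _ \<eta>] conjI)
qed

section \<open>Random grids symmetric about the origin\<close>

text \<open>The grid points are \<open>\<plusminus>(s + n)\<close> for \<open>n \<ge> 0\<close>. The label is odd and monotone in \<open>x\<close>, and its mean over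
  \<open>s \<in> [0, 1]\<close> is \<open>x\<close>; hence the mean distance of two labels is the distance of the points.\<close>

definition grid_label :: "real \<Rightarrow> real \<Rightarrow> int" where
  "grid_label s x = (if x = 0 then 0 else if x > 0 then \<lfloor>x - s\<rfloor> + 1 else - (\<lfloor>- x - s\<rfloor> + 1))"

lemma grid_label_0 [simp]: "grid_label s 0 = 0"
  by (simp add: grid_label_def)

lemma grid_label_minus: "grid_label s (- x) = - grid_label s x"
  by (auto simp: grid_label_def)

lemma grid_label_nonneg: "x \<ge> 0 \<Longrightarrow> s \<le> 1 \<Longrightarrow> grid_label s x \<ge> 0"
  by (auto simp: grid_label_def) linarith

lemma grid_label_mono:
  assumes "x \<le> y" "s \<le> 1"
  shows "grid_label s x \<le> grid_label s y"
proof -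
  consider "x \<le> 0" "0 \<le> y" | "0 < x" | "y < 0" by linarith
  then show ?thesis
  proof cases
    case 1
    then show ?thesis
      using grid_label_nonneg[of y s] grid_label_nonneg[of "- x" s] assms grid_label_minus[of s x] by linarith
  next
    case 2
    then show ?thesis using assms by (auto simp: grid_label_def intro: floor_mono)
  next
    case 3
    then show ?thesis using assms floor_mono[of "- y - s" "- x - s"] by (auto simp: grid_label_def)
  qed
qed

lemma grid_label_eq_0_imp:
  assumes "grid_label s x = 0" "0 \<le> s" "s \<le> 1"
  shows "\<bar>x\<bar> \<le> 1"
  using assms by (auto simp: grid_label_def split: if_splits) linarith+

text \<open>The cell of label 0 is the interval around 0 bounded by \<open>-s\<close> and
  \<open>s\<close>, of length up to 2; all other cells have length at most 1.\<close>

lemma grid_label_eq_imp: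
  assumes "grid_label s x = grid_label s y" "0 \<le> s" "s \<le> 1"
  shows "\<bar>x - y\<bar> \<le> 2"
proof -
  have aux: "\<bar>x - y\<bar> \<le> 2" if "x > 0" and eq: "grid_label s x = grid_label s y" for x y
  proof -
    consider "y > 0" | "y \<le> 0" by linarith
    then show ?thesis
    proof cases
      case 1
      then have "\<lfloor>x - s\<rfloor> = \<lfloor>y - s\<rfloor>" using \<open>x > 0\<close> eq by (simp add: grid_label_def)
      then show ?thesis by linarith
    next
      case 2
      then have "grid_label s x = 0"
        using \<open>x > 0\<close> eq assms grid_label_nonneg[of x s] grid_label_mono[of y 0 s] by simp
      then show ?thesis
        using grid_label_eq_0_imp[of s x] grid_label_eq_0_imp[of s y] eq assms by auto
    qed
  qed
  consider "x > 0" | "x = 0" | "- x > 0" by linarith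
  then show ?thesis
  proof cases
    case 1
    then show ?thesis using aux assms by blast
  next
    case 2
    then show ?thesis using grid_label_eq_0_imp[of s y] assms by auto
  next
    case 3
    then show ?thesis using aux[of "- x" "- y"] assms by (auto simp: grid_label_minus)
  qed
qed

text \<open>As \<open>s\<close> grows from 0 to 1, the floor drops by one exactly once, just after
  \<open>s = frac x\<close>. The drop point itself still has the old value and is discarded as a
  null set.\<close>

lemma has_integral_floor_shift:
  fixes x :: real
  shows "((\<lambda>s. real_of_int \<lfloor>x - s\<rfloor>) has_integral (x - 1)) {0..1}"
proof -
  let ?c = "frac x"
  have c: "0 \<le> ?c" "?c \<le> 1" by (auto simp: frac_ge_0 less_imp_le[OF frac_lt_1])
  have "((\<lambda>s. real_of_int \<lfloor>x - s\<rfloor>) has_integral (of_int \<lfloor>x\<rfloor> * ?c)) {0..?c}"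
  proof (rule has_integral_spike[where S = "{}"])
    show "((\<lambda>s. of_int \<lfloor>x\<rfloor>) has_integral of_int \<lfloor>x\<rfloor> * ?c) {0..?c}"
      using has_integral_const_real[of "real_of_int \<lfloor>x\<rfloor>" 0 ?c] c by (simp add: mult.commute)
    show "real_of_int \<lfloor>x - s\<rfloor> = of_int \<lfloor>x\<rfloor>" if "s \<in> {0..?c} - {}" for s
      using that by (auto simp: frac_def floor_eq_iff) linarith+
  qed simp
  moreover have "((\<lambda>s. real_of_int \<lfloor>x - s\<rfloor>) has_integral ((of_int \<lfloor>x\<rfloor> - 1) * (1 - ?c))) {?c..1}"
  proof (rule has_integral_spike[where S = "{?c}"])
    show "((\<lambda>s. real_of_int \<lfloor>x\<rfloor> - 1) has_integral (of_int \<lfloor>x\<rfloor> - 1) * (1 - ?c)) {?c..1}"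
      using has_integral_const_real[of "real_of_int \<lfloor>x\<rfloor> - 1" ?c 1] c by (simp add: mult.commute)
    show "real_of_int \<lfloor>x - s\<rfloor> = of_int \<lfloor>x\<rfloor> - 1" if "s \<in> {?c..1} - {?c}" for s
    proof -
      have "\<lfloor>x - s\<rfloor> = \<lfloor>x\<rfloor> - 1" using that by (auto simp: frac_def floor_eq_iff) linarith+
      then show ?thesis by simp
    qed
  qed simp
  ultimately have "((\<lambda>s. real_of_int \<lfloor>x - s\<rfloor>) has_integral
      (of_int \<lfloor>x\<rfloor> * ?c + (of_int \<lfloor>x\<rfloor> - 1) * (1 - ?c))) {0..1}"
    using c by (intro has_integral_combine[of 0 ?c 1])
  moreover have "of_int \<lfloor>x\<rfloor> * ?c + (of_int \<lfloor>x\<rfloor> - 1) * (1 - ?c) = x - 1"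
    by (simp add: frac_def algebra_simps)
  ultimately show ?thesis by simp
qed

lemma has_integral_grid_label: "((\<lambda>s. real_of_int (grid_label s x)) has_integral x) {0..1}"
proof -
  have pos: "((\<lambda>s. real_of_int (grid_label s x)) has_integral x) {0..1}" if "x > 0" for x
    using has_integral_add[OF has_integral_floor_shift[of x] has_integral_const_real[of 1 0 1]] that
    by (simp add: grid_label_def)
  consider "x > 0" | "x = 0" | "- x > 0" by linarith
  then show ?thesis
  proof cases
    case 3
    then show ?thesis using has_integral_neg[OF pos[of "- x"]] by (simp add: grid_label_minus)
  qed (auto intro: pos)
qed

text \<open>By monotonicity the difference of two labels has the same sign for every
  \<open>s\<close>, so the absolute value commutes with the integral. Oddness turns differences into
  sums.\<close>

lemma has_integral_grid_label_dist:
  "((\<lambda>s. \<bar>real_of_int (grid_label s x + grid_label s y)\<bar>) has_integral \<bar>x + y\<bar>) {0..1}"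
proof -
  have "((\<lambda>s. \<bar>real_of_int (grid_label s x - grid_label s y)\<bar>) has_integral \<bar>x - y\<bar>) {0..1}"
    if "y \<le> x" for x y
  proof (rule has_integral_spike[where S = "{}"])
    show "((\<lambda>s. real_of_int (grid_label s x) - real_of_int (grid_label s y)) has_integral \<bar>x - y\<bar>) {0..1}"
      using has_integral_diff[OF has_integral_grid_label[of x] has_integral_grid_label[of y]] that by simp
    show "\<bar>real_of_int (grid_label s x - grid_label s y)\<bar> =
        real_of_int (grid_label s x) - real_of_int (grid_label s y)" if "s \<in> {0..1} - {}" for s
      using grid_label_mono[OF \<open>y \<le> x\<close>, of s] that by simp
  qed simp
  from this[of "- y" x] this[of x "- y"] show ?thesis
    by (cases "- y \<le> x") (auto simp: grid_label_minus abs_minus_commute add.commute)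
qed

lemma has_integral_indicator_le:
  fixes a T :: real
  assumes "0 \<le> a" "a \<le> T"
  shows "((\<lambda>t. of_bool (t \<le> a)) has_integral a) {0..T}"
proof -
  have "((\<lambda>t. of_bool (t \<le> a)) has_integral a) {0..a}"
  proof (rule has_integral_spike[where S = "{}"])
    show "((\<lambda>t. 1) has_integral a) {0..a}" using has_integral_const_real[of "1::real" 0 a] assms by simp
  qed auto
  moreover have "((\<lambda>t. of_bool (t \<le> a) :: real) has_integral 0) {a..T}"
    by (rule has_integral_spike[where S = "{a}" and f = "\<lambda>_. 0"]) auto
  ultimately show ?thesis
    using has_integral_combine[OF assms, where f = "\<lambda>t. of_bool (t \<le> a)" and i = a and j = 0] by simp
qed

section \<open>Splitting a large sum\<close>

text \<open>Take a subset of least cardinality with sum at least 1/2. Either one of its elements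
  alone reaches 1/2, or dropping an element smaller than 1/2 brings the sum below 1/2, so that the
  sum was at most 1.\<close>

lemma subset_of_moderate_sum:
  fixes m :: "'a \<Rightarrow> real"
  assumes "finite X" "\<And>x. x \<in> X \<Longrightarrow> m x \<le> b" "1 \<le> b" "1/2 \<le> sum m X"
  shows "\<exists>Y\<subseteq>X. 1/2 \<le> sum m Y \<and> sum m Y \<le> b"
proof -
  obtain Y where Y: "Y \<subseteq> X \<and> 1/2 \<le> sum m Y"
    and min: "\<And>Z. Z \<subseteq> X \<and> 1/2 \<le> sum m Z \<Longrightarrow> card Y \<le> card Z"
    using ex_has_least_nat[of "\<lambda>Y. Y \<subseteq> X \<and> 1/2 \<le> sum m Y" X card] assms(4) by blast
  have "finite Y" using Y assms(1) finite_subset by blast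
  have "Y \<noteq> {}" using Y by auto
  then obtain y where y: "y \<in> Y" by blast
  show ?thesis
  proof (cases "1/2 \<le> m y")
    case True
    then show ?thesis using y Y assms(2)[of y] by (intro exI[of _ "{y}"]) auto
  next
    case False
    have "card (Y - {y}) < card Y" using y \<open>finite Y\<close> by (meson card_Diff1_less)
    then have "sum m (Y - {y}) < 1/2" using min[of "Y - {y}"] Y by force
    then have "sum m Y \<le> 1" using False sum.remove[OF \<open>finite Y\<close> y, of m] by simp
    then show ?thesis using Y assms(3) by (intro exI[of _ Y]) simp
  qed
qed

text \<open>Greedy choice: each chosen set uses up at most \<open>b\<close>, and the hypothesis
  leaves 1/2 after \<open>k - 1\<close> choices. The summand \<open>b\<close> stands on the right so
  that the induction can start at \<open>k = 0\<close>.\<close>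

lemma disjoint_subsets_of_large_sum:
  fixes m :: "'a \<Rightarrow> real"
  assumes "finite X" "\<And>x. x \<in> X \<Longrightarrow> m x \<le> b" "1 \<le> b" "real k * b + 1/2 \<le> sum m X + b"
  shows "\<exists>G. (\<forall>i<k. G i \<subseteq> X \<and> 1/2 \<le> sum m (G i)) \<and> (\<forall>i<k. \<forall>j<k. i \<noteq> j \<longrightarrow> G i \<inter> G j = {})"
  using assms
proof (induction k arbitrary: X)
  case (Suc k)
  have "real k * b \<ge> 0" using Suc.prems(3) by simp
  then have "1/2 \<le> sum m X" using Suc.prems(4) by (simp add: algebra_simps)
  then obtain Y where Y: "Y \<subseteq> X" "1/2 \<le> sum m Y" "sum m Y \<le> b"
    using subset_of_moderate_sum[of X m b] Suc.prems(1-3) by blast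
  have "sum m (X - Y) = sum m X - sum m Y" using Suc.prems(1) Y(1) by (rule sum_diff)
  then have "real k * b + 1/2 \<le> sum m (X - Y) + b" using Suc.prems(4) Y(3) by (simp add: algebra_simps)
  then obtain G where G: "\<forall>i<k. G i \<subseteq> X - Y \<and> 1/2 \<le> sum m (G i)"
    "\<forall>i<k. \<forall>j<k. i \<noteq> j \<longrightarrow> G i \<inter> G j = {}"
    using Suc.IH[of "X - Y"] Suc.prems by auto
  show ?case
  proof (intro exI[of _ "G(k := Y)"] conjI allI impI)
    fix i assume "i < Suc k"
    then show "(G(k := Y)) i \<subseteq> X" "1/2 \<le> sum m ((G(k := Y)) i)"
      using G(1) Y by (auto simp: less_Suc_eq)
  next
    fix i j assume "i < Suc k" "j < Suc k" "i \<noteq> j"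
    then consider "i < k" "j < k" | "i = k" "j < k" | "i < k" "j = k" by linarith
    then show "(G(k := Y)) i \<inter> (G(k := Y)) j = {}"
    proof cases
      case 1
      then show ?thesis using G(2) \<open>i \<noteq> j\<close> by simp
    next
      case 2
      then have "G j \<subseteq> X - Y" using G(1) by blast
      then show ?thesis using 2 by auto
    next
      case 3
      then have "G i \<subseteq> X - Y" using G(1) by blast
      then show ?thesis using 3 by auto
    qed
  qed
qed simp

section \<open>The signless Laplacian\<close>

text \<open>Symmetric matrix of the form \<open>f \<mapsto> ((2 - \<Delta>) f, f)\<^sub>\<mu>\<close>.\<close>

definition signless :: "nat \<Rightarrow> (nat \<Rightarrow> nat \<Rightarrow> real) \<Rightarrow> nat \<Rightarrow> nat \<Rightarrow> real" where
  "signless N w u v = (if u = v then deg N w u else 0) + w u v"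

lemma deg_pos: "wgraph N w \<Longrightarrow> u < N \<Longrightarrow> deg N w u > 0"
  unfolding wgraph_def deg_def by blast

lemma bform_signless:
  "bform N (signless N w) f g = wip N (deg N w) f g + (\<Sum>u<N. \<Sum>v<N. w u v * f u * g v)"
proof -
  have "(\<Sum>v<N. (if u = v then deg N w u else 0) * f u * g v) = deg N w u * f u * g u" if "u < N" for u
  proof -
    have "(\<Sum>v<N. (if u = v then deg N w u else 0) * f u * g v) =
        (\<Sum>v<N. if u = v then deg N w u * f u * g v else 0)" by (intro sum.cong) auto
    then show ?thesis using that by simp
  qed
  then show ?thesis
    by (simp add: bform_def signless_def wip_def distrib_right sum.distrib)
qed

lemma sum_deg:
  "(\<Sum>u<N. deg N w u * f u) = (\<Sum>u<N. \<Sum>v<N. w u v * f u)"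
  by (simp add: deg_def sum_distrib_right)

lemma sum_deg':
  assumes "wgraph N w"
  shows "(\<Sum>u<N. deg N w u * f u) = (\<Sum>u<N. \<Sum>v<N. w u v * f v)"
  unfolding sum_deg by (subst sum.swap) (intro sum.cong refl, use assms in \<open>simp add: wgraph_def\<close>)

lemma bform_signless_diag:
  assumes "wgraph N w"
  shows "2 * bform N (signless N w) f f = (\<Sum>u<N. \<Sum>v<N. w u v * (f u + f v)\<^sup>2)"
proof -
  have "(\<Sum>u<N. \<Sum>v<N. w u v * (f u + f v)\<^sup>2) =
      (\<Sum>u<N. \<Sum>v<N. w u v * (f u)\<^sup>2) + (\<Sum>u<N. \<Sum>v<N. w u v * (f v)\<^sup>2)
      + 2 * (\<Sum>u<N. \<Sum>v<N. w u v * f u * f v)"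
    by (simp add: sum_distrib_left sum.distrib[symmetric] power2_eq_square algebra_simps)
  then show ?thesis
    unfolding sum_deg[symmetric] sum_deg'[OF assms, symmetric] bform_signless
    by (simp add: wip_def power2_eq_square mult.assoc)
qed

lemma bform_signless_nonneg:
  assumes "wgraph N w"
  shows "0 \<le> bform N (signless N w) f f"
proof -
  have "0 \<le> (\<Sum>u<N. \<Sum>v<N. w u v * (f u + f v)\<^sup>2)"
    using assms unfolding wgraph_def by (intro sum_nonneg) simp
  then show ?thesis using bform_signless_diag[OF assms, of f] by simp
qed

lemma proots_prod_list_linear: "proots (\<Prod>a\<leftarrow>xs. [:- a, 1::real:]) = mset xs"
proof (induction xs)
  case (Cons a xs)
  have "(\<Prod>a\<leftarrow>xs. [:- a, 1::real:]) \<noteq> 0" by (auto simp: prod_list_zero_iff)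
  then show ?case using Cons by (simp add: proots_mult del: mult_pCons_left)
qed simp

text \<open>The eigenfunctions are the columns of \<open>U\<close>, and orthonormality makes
  \<open>U'\<close> its inverse; conjugation by \<open>U\<close> turns the Laplacian into the
  diagonal matrix of the \<open>2 - \<eta> i\<close>, from which the characteristic polynomial is
  read off.\<close>

lemma lap_eig_eq:
  assumes G: "wgraph N w"
    and orth: "\<forall>i<N. \<forall>j<N. wip N (deg N w) (g i) (g j) = (if i = j then 1 else 0)"
    and eig: "\<forall>i<N. \<forall>h. bform N (signless N w) h (g i) = \<eta> i * wip N (deg N w) h (g i)"
    and mono: "\<forall>j<N. \<forall>i\<le>j. \<eta> i \<le> \<eta> j"
    and k: "1 \<le> k" "k \<le> N"
  shows "lap_eig N w (N - k + 1) = 2 - \<eta> (k - 1)"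
proof -
  let ?L = "norm_laplacian N w"
  define U where "U = Matrix.mat N N (\<lambda>(u,i). g i u)"
  define U' where "U' = Matrix.mat N N (\<lambda>(i,u). deg N w u * g i u)"
  define D where "D = Matrix.mat N N (\<lambda>(i,j). if i = j then 2 - \<eta> i else 0)"
  have carr: "U \<in> carrier_mat N N" "U' \<in> carrier_mat N N" "D \<in> carrier_mat N N" "?L \<in> carrier_mat N N"
    by (simp_all add: U_def U'_def D_def norm_laplacian_def)
  have "U' * U = 1\<^sub>m N"
    using orth by (intro eq_matI)
      (auto simp: U_def U'_def scalar_prod_def wip_def lessThan_atLeast0)
  then have UU': "U * U' = 1\<^sub>m N" using mat_mult_left_right_inverse carr by blast
  have pointwise: "(\<Sum>v<N. w u v * g i v) = (\<eta> i - 1) * deg N w u * g i u" if "u < N" "i < N" for u i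
  proof -
    \<comment> \<open>Testing the weak eigenvalue equation against the indicator of \<open>u\<close>
      yields its value at \<open>u\<close>.\<close>
    let ?h = "\<lambda>v. of_bool (v = u) :: real"
    have "wip N (deg N w) ?h (g i) = deg N w u * g i u"
      using that by (simp add: wip_def of_bool_def if_distrib if_distribR cong: if_cong)
    moreover have "(\<Sum>u'<N. \<Sum>v<N. w u' v * ?h u' * g i v) = (\<Sum>v<N. w u v * g i v)"
    proof -
      have "(\<Sum>u'<N. \<Sum>v<N. w u' v * ?h u' * g i v) = (\<Sum>u'<N. if u' = u then \<Sum>v<N. w u' v * g i v else 0)"
        by (intro sum.cong) auto
      then show ?thesis using that by simp
    qed
    ultimately show ?thesis
      using eig[rule_format, OF that(2), of ?h] by (simp add: bform_signless algebra_simps)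
  qed
  have LU: "?L * U = U * D"
  proof (intro eq_matI)
    fix u i assume "u < dim_row (U * D)" "i < dim_col (U * D)"
    then have ui: "u < N" "i < N" using carr by auto
    have "(?L * U) $$ (u, i) = (\<Sum>v<N. ((if u = v then 1 else 0) - w u v / deg N w u) * g i v)"
      using ui by (simp add: U_def norm_laplacian_def scalar_prod_def lessThan_atLeast0)
    also have "\<dots> = (\<Sum>v<N. if u = v then g i v else 0) - (\<Sum>v<N. w u v * g i v) / deg N w u"
      unfolding sum_divide_distrib sum_subtractf[symmetric] by (intro sum.cong) (auto simp: algebra_simps)
    also have "\<dots> = (2 - \<eta> i) * g i u"
      using ui deg_pos[OF G ui(1)] unfolding pointwise[OF ui] by (simp add: field_simps)
    also have "\<dots> = (\<Sum>j<N. if j = i then g j u * (2 - \<eta> j) else 0)" using ui by simp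
    also have "\<dots> = (\<Sum>j<N. g j u * (if j = i then 2 - \<eta> j else 0))" by (intro sum.cong) auto
    also have "\<dots> = (U * D) $$ (u, i)"
      using ui by (simp add: U_def D_def scalar_prod_def lessThan_atLeast0)
    finally show "(?L * U) $$ (u, i) = (U * D) $$ (u, i)" .
  qed (use carr in auto)
  have "?L = ?L * (U * U')" using carr UU' by simp
  also have "\<dots> = U * D * U'" using carr LU by (metis assoc_mult_mat)
  finally have "similar_mat ?L D"
    unfolding similar_mat_def using carr UU' \<open>U' * U = 1\<^sub>m N\<close>
    by (intro exI[of _ U] exI[of _ U'] similar_mat_witI[of _ _ N]) auto
  then have "char_poly ?L = char_poly D" by (rule char_poly_similar)
  also have "\<dots> = (\<Prod>a\<leftarrow>diag_mat D. [:- a, 1:])"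
    using carr by (intro char_poly_upper_triangular) (auto simp: D_def)
  finally have roots: "proots (char_poly ?L) = mset (diag_mat D)"
    by (simp add: proots_prod_list_linear)
  define xs where "xs = map (\<lambda>i. 2 - \<eta> i) [0..<N]"
  have "diag_mat D = xs" by (simp add: diag_mat_def D_def xs_def)
  \<comment> \<open>\<open>2 - \<eta> i\<close> decreases in \<open>i\<close>, so sorting reverses
    the list: position \<open>N - k\<close>, counted from 0, of the sorted list is position
    \<open>k - 1\<close> of \<open>xs\<close>.\<close>
  moreover have "sort xs = rev xs"
    using mono by (intro properties_for_sort) (auto simp: sorted_iff_nth_mono rev_nth xs_def)
  ultimately have "lap_eig N w (N - k + 1) = rev xs ! (N - k)"
    by (simp add: lap_eig_def roots)
  also have "\<dots> = 2 - \<eta> (k - 1)" using k by (simp add: rev_nth xs_def)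
  finally show ?thesis .
qed

section \<open>Edge weights between sets and the min-max bound for the eigenvalue\<close>

lemma sum_subset_of_bool:
  fixes h :: "nat \<Rightarrow> real"
  assumes "A \<subseteq> {..<N}"
  shows "sum h A = (\<Sum>u<N. of_bool (u \<in> A) * h u)"
proof -
  have "sum h A = (\<Sum>u\<in>A. of_bool (u \<in> A) * h u)" by (intro sum.cong) auto
  also have "\<dots> = (\<Sum>u<N. of_bool (u \<in> A) * h u)" using assms by (intro sum.mono_neutral_left) auto
  finally show ?thesis .
qed

lemma edges_between_of_bool:
  assumes "A \<subseteq> {..<N}" "B \<subseteq> {..<N}"
  shows "edges_between w A B = (\<Sum>u<N. \<Sum>v<N. w u v * (of_bool (u \<in> A) * of_bool (v \<in> B)))"
  unfolding edges_between_def sum_subset_of_bool[OF assms(1)] sum_subset_of_bool[OF assms(2)]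
  unfolding sum_distrib_left by (intro sum.cong refl) (simp only: mult_ac)

lemma edges_between_commute:
  assumes "wgraph N w" "A \<subseteq> {..<N}" "B \<subseteq> {..<N}"
  shows "edges_between w A B = edges_between w B A"
  unfolding edges_between_def
proof (subst sum.swap, intro sum.cong refl)
  fix u v assume "u \<in> B" "v \<in> A"
  then have "u < N" "v < N" using assms(2,3) by auto
  then show "w v u = w u v" using assms(1) unfolding wgraph_def by blast
qed

lemma sum_opposite_sides:
  assumes G: "wgraph N w" and A: "A \<subseteq> {..<N}" and B: "B \<subseteq> {..<N}" and disj: "A \<inter> B = {}"
  shows "(\<Sum>u<N. \<Sum>v<N. w u v * of_bool (u \<in> A \<and> v \<in> B \<or> u \<in> B \<and> v \<in> A)) = 2 * edges_between w A B"
proof -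
  have "2 * edges_between w A B = edges_between w A B + edges_between w B A"
    using edges_between_commute[OF G A B] by simp
  also have "\<dots> = (\<Sum>u<N. \<Sum>v<N. w u v * (of_bool (u \<in> A) * of_bool (v \<in> B) + of_bool (u \<in> B) * of_bool (v \<in> A)))"
    by (simp add: edges_between_of_bool[OF A B] edges_between_of_bool[OF B A] sum.distrib distrib_left)
  also have "\<dots> = (\<Sum>u<N. \<Sum>v<N. w u v * of_bool (u \<in> A \<and> v \<in> B \<or> u \<in> B \<and> v \<in> A))"
    using disj by (intro sum.cong refl arg_cong2[where f = "(*)"]) (auto simp: of_bool_def)
  finally show ?thesis by simp
qed

lemma vol_pos:
  assumes "wgraph N w" "A \<subseteq> {..<N}" "A \<noteq> {}"
  shows "vol N w A > 0"
  unfolding vol_def using assms finite_subset[OF assms(2)]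
  by (intro sum_pos) (auto intro!: deg_pos)

lemma signless_eigenvalue_le:
  assumes G: "wgraph N w" and k: "1 \<le> k" and S: "sub_bipartition N k S"
    and min: "\<forall>f. (\<forall>j<k-1. wip N (deg N w) f (g j) = 0) \<longrightarrow>
      \<eta> * wip N (deg N w) f f \<le> bform N (signless N w) f f"
    and M: "\<And>i. i < k \<Longrightarrow> M \<le> bip_ratio N w (S (2*i)) (S (2*i+1))"
  shows "\<eta> \<le> 2 * (1 - M)"
proof -
  define A where "A i = S (2 * i)" for i
  define B where "B i = S (2 * i + 1)" for i
  have sub: "A i \<subseteq> {..<N}" "B i \<subseteq> {..<N}" if "i < k" for i
    using S that unfolding sub_bipartition_def A_def B_def by simp_all
  have ne: "A i \<union> B i \<noteq> {}" if "i < k" for i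
    using S that unfolding sub_bipartition_def A_def B_def by simp
  have disj: "S p \<inter> S q = {}" if "p < 2 * k" "q < 2 * k" "p \<noteq> q" for p q
    using S that unfolding sub_bipartition_def by blast
  have AB: "A i \<inter> B j = {}" if "i < k" "j < k" for i j
    unfolding A_def B_def using that by (intro disj) presburger+
  have AA: "A i \<inter> A j = {}" "B i \<inter> B j = {}" if "i < k" "j < k" "i \<noteq> j" for i j
    unfolding A_def B_def using that by (intro disj; simp)+
  define \<psi> where "\<psi> i v = (of_bool (v \<in> A i) - of_bool (v \<in> B i) :: real)" for i v
  \<comment> \<open>A combination of the \<open>k\<close> trial functions that meets the
    \<open>k - 1\<close> orthogonality conditions of the minimum problem.\<close>
  obtain x where x: "\<exists>i<k. x i \<noteq> 0"
    "\<And>j. j < k - 1 \<Longrightarrow> (\<Sum>i<k. wip N (deg N w) (\<psi> i) (g j) * x i) = 0"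
    by (rule homogeneous_system_nontrivial[of "k - 1" k "\<lambda>j i. wip N (deg N w) (\<psi> i) (g j)"]) (use k that in auto)
  define f where "f v = (\<Sum>i<k. x i * \<psi> i v)" for v
  have f_at: "f v = x i * \<psi> i v" if "i < k" "v \<in> A i \<union> B i" for i v
  proof -
    have "f v = (\<Sum>j<k. if j = i then x i * \<psi> i v else 0)"
      unfolding f_def
    proof (intro sum.cong refl)
      fix j assume "j \<in> {..<k}"
      then show "x j * \<psi> j v = (if j = i then x i * \<psi> i v else 0)"
        using that AA[of i j] AB[of i j] AB[of j i] unfolding \<psi>_def by auto
    qed
    then show ?thesis using that by simp
  qed
  have f_out: "f v = 0" if "\<And>i. i < k \<Longrightarrow> v \<notin> A i \<union> B i" for v
    unfolding f_def using that by (intro sum.neutral) (auto simp: \<psi>_def)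
  have f_sq: "(f v)\<^sup>2 = (\<Sum>i<k. (x i)\<^sup>2 * of_bool (v \<in> A i \<union> B i))" for v
  proof (cases "\<exists>i<k. v \<in> A i \<union> B i")
    case True
    then obtain i where i: "i < k" "v \<in> A i \<union> B i" by blast
    have "(\<Sum>j<k. (x j)\<^sup>2 * of_bool (v \<in> A j \<union> B j)) = (\<Sum>j<k. if j = i then (x i)\<^sup>2 else 0)"
    proof (intro sum.cong refl)
      fix j assume "j \<in> {..<k}"
      then show "(x j)\<^sup>2 * of_bool (v \<in> A j \<union> B j) = (if j = i then (x i)\<^sup>2 else 0)"
        using i AA[of i j] AB[of i j] AB[of j i] by auto
    qed
    moreover have "(\<psi> i v)\<^sup>2 = 1" using i AB[of i i] by (auto simp: \<psi>_def)
    ultimately show ?thesis using i f_at[OF i] by (simp add: power_mult_distrib)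
  next
    case False
    then show ?thesis using f_out[of v] by simp
  qed
  have norm_f: "wip N (deg N w) f f = (\<Sum>i<k. (x i)\<^sup>2 * vol N w (A i \<union> B i))"
  proof -
    have "wip N (deg N w) f f = (\<Sum>v<N. \<Sum>i<k. (x i)\<^sup>2 * (of_bool (v \<in> A i \<union> B i) * deg N w v))"
      unfolding wip_def
    proof (intro sum.cong refl)
      fix v
      have "deg N w v * f v * f v = deg N w v * (f v)\<^sup>2" by (simp add: power2_eq_square)
      then show "deg N w v * f v * f v = (\<Sum>i<k. (x i)\<^sup>2 * (of_bool (v \<in> A i \<union> B i) * deg N w v))"
        unfolding f_sq sum_distrib_left by (simp only: mult_ac)
    qed
    also have "\<dots> = (\<Sum>i<k. (x i)\<^sup>2 * (\<Sum>v<N. of_bool (v \<in> A i \<union> B i) * deg N w v))"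
      by (subst sum.swap) (simp add: sum_distrib_left)
    also have "\<dots> = (\<Sum>i<k. (x i)\<^sup>2 * vol N w (A i \<union> B i))"
      unfolding vol_def using sub by (intro sum.cong refl) (subst sum_subset_of_bool, auto)
    finally show ?thesis .
  qed
  let ?opp = "\<lambda>i u v. of_bool (u \<in> A i \<and> v \<in> B i \<or> u \<in> B i \<and> v \<in> A i) :: real"
  \<comment> \<open>Equality holds for \<open>u\<close>, \<open>v\<close> on opposite sides of pair
    \<open>i\<close>: the product is \<open>-(x i)^2\<close> and both squares are
    \<open>(x i)^2\<close>. In all other cases the sum is 0 and this is the arithmetic-geometric
    mean inequality.\<close>
  have pointwise: "f u * f v \<le> ((f u)\<^sup>2 + (f v)\<^sup>2) / 2 - 2 * (\<Sum>i<k. (x i)\<^sup>2 * ?opp i u v)" for u v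
  proof (cases "\<exists>i<k. u \<in> A i \<and> v \<in> B i \<or> u \<in> B i \<and> v \<in> A i")
    case True
    then obtain i where i: "i < k" "u \<in> A i \<and> v \<in> B i \<or> u \<in> B i \<and> v \<in> A i" by blast
    have "(\<Sum>j<k. (x j)\<^sup>2 * ?opp j u v) = (\<Sum>j<k. if j = i then (x i)\<^sup>2 else 0)"
    proof (intro sum.cong refl)
      fix j assume "j \<in> {..<k}"
      then show "(x j)\<^sup>2 * ?opp j u v = (if j = i then (x i)\<^sup>2 else 0)"
        using i AA[of i j] AB[of i j] AB[of j i] by auto
    qed
    moreover have "f u * f v = - (x i)\<^sup>2" "(f u)\<^sup>2 = (x i)\<^sup>2" "(f v)\<^sup>2 = (x i)\<^sup>2"
      using i f_at[OF i(1), of u] f_at[OF i(1), of v] AB[of i i]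
      by (auto simp: \<psi>_def power2_eq_square)
    ultimately show ?thesis using i by simp
  next
    case False
    then have "(\<Sum>i<k. (x i)\<^sup>2 * ?opp i u v) = 0" by (intro sum.neutral) auto
    then show ?thesis using sum_squares_bound[of "f u" "f v"] by simp
  qed
  have "(\<Sum>u<N. \<Sum>v<N. w u v * f u * f v) \<le>
      (\<Sum>u<N. \<Sum>v<N. w u v * (((f u)\<^sup>2 + (f v)\<^sup>2) / 2 - 2 * (\<Sum>i<k. (x i)\<^sup>2 * ?opp i u v)))"
    using G pointwise unfolding wgraph_def
    by (intro sum_mono) (simp add: mult.assoc mult_left_mono)
  also have "\<dots> = (\<Sum>u<N. \<Sum>v<N. w u v * (f u)\<^sup>2) / 2 + (\<Sum>u<N. \<Sum>v<N. w u v * (f v)\<^sup>2) / 2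
      - 2 * (\<Sum>u<N. \<Sum>v<N. \<Sum>i<k. (x i)\<^sup>2 * (w u v * ?opp i u v))"
    by (simp add: sum.distrib sum_subtractf sum_divide_distrib sum_distrib_left algebra_simps add_divide_distrib)
  also have "(\<Sum>u<N. \<Sum>v<N. \<Sum>i<k. (x i)\<^sup>2 * (w u v * ?opp i u v)) =
      (\<Sum>u<N. \<Sum>i<k. \<Sum>v<N. (x i)\<^sup>2 * (w u v * ?opp i u v))"
    by (intro sum.cong refl sum.swap)
  also have "\<dots> = (\<Sum>i<k. (x i)\<^sup>2 * (\<Sum>u<N. \<Sum>v<N. w u v * ?opp i u v))"
    unfolding sum_distrib_left by (rule sum.swap)
  also have "\<dots> = (\<Sum>i<k. (x i)\<^sup>2 * (2 * edges_between w (A i) (B i)))"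
    using sum_opposite_sides[OF G] sub AB by (intro sum.cong refl) simp
  finally have "bform N (signless N w) f f \<le>
      2 * wip N (deg N w) f f - 2 * (\<Sum>i<k. (x i)\<^sup>2 * (2 * edges_between w (A i) (B i)))"
    unfolding sum_deg[symmetric] sum_deg'[OF G, symmetric] bform_signless
    by (simp add: wip_def power2_eq_square mult.assoc)
  also have "\<dots> = (\<Sum>i<k. 2 * (x i)\<^sup>2 * (vol N w (A i \<union> B i) - 2 * edges_between w (A i) (B i)))"
    by (simp add: norm_f sum_distrib_left sum_subtractf algebra_simps)
  also have "\<dots> \<le> (\<Sum>i<k. 2 * (x i)\<^sup>2 * ((1 - M) * vol N w (A i \<union> B i)))"
  proof (intro sum_mono mult_left_mono)
    fix i assume "i \<in> {..<k}"
    then have i: "i < k" by simp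
    have "vol N w (A i \<union> B i) > 0" using vol_pos[OF G _ ne[OF i]] sub[OF i] by simp
    moreover have "M \<le> bip_ratio N w (A i) (B i)" using M[OF i] by (simp add: A_def B_def)
    ultimately show "vol N w (A i \<union> B i) - 2 * edges_between w (A i) (B i) \<le> (1 - M) * vol N w (A i \<union> B i)"
      by (simp add: bip_ratio_def field_simps)
  qed simp
  also have "\<dots> = 2 * (1 - M) * wip N (deg N w) f f"
    unfolding norm_f sum_distrib_left by (intro sum.cong refl) (simp add: algebra_simps)
  finally have "bform N (signless N w) f f \<le> 2 * (1 - M) * wip N (deg N w) f f" .
  moreover have "wip N (deg N w) f (g j) = 0" if "j < k - 1" for j
    using x(2)[OF that] by (simp add: f_def[abs_def] wip_sum_left wip_scale_left mult_ac)
  then have "\<eta> * wip N (deg N w) f f \<le> bform N (signless N w) f f" using min by blast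
  moreover have "wip N (deg N w) f f > 0"
  proof -
    obtain i where i: "i < k" "x i \<noteq> 0" using x(1) by blast
    have "vol N w (A j \<union> B j) > 0" if "j < k" for j
      using vol_pos[OF G _ ne[OF that]] sub[OF that] by simp
    then show ?thesis unfolding norm_f using i
      by (intro sum_pos2[of _ i]) (auto simp: less_imp_le)
  qed
  ultimately show ?thesis using mult_right_le_imp_le[of \<eta> "wip N (deg N w) f f" "2 * (1 - M)"] by linarith
qed

section \<open>The dual Cheeger constant as an attained maximum\<close>

lemma dual_cheeger_finite:
  assumes "1 \<le> k"
  shows "finite {Min ((\<lambda>i. bip_ratio N w (S (2*i)) (S (2*i+1))) ` {..<k}) | S. sub_bipartition N k S}"
proof (rule finite_subset)
  \<comment> \<open>There are infinitely many \<open>S\<close>, being arbitrary from index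
    \<open>2 * k\<close> on, but every minimum is the ratio of one pair of subsets of a finite
    set.\<close>
  show "{Min ((\<lambda>i. bip_ratio N w (S (2*i)) (S (2*i+1))) ` {..<k}) | S. sub_bipartition N k S}
      \<subseteq> (\<lambda>(A, B). bip_ratio N w A B) ` (Pow {..<N} \<times> Pow {..<N})"
  proof safe
    fix S assume S: "sub_bipartition N k S"
    have "Min ((\<lambda>i. bip_ratio N w (S (2*i)) (S (2*i+1))) ` {..<k}) \<in>
        (\<lambda>i. bip_ratio N w (S (2*i)) (S (2*i+1))) ` {..<k}"
      using assms by (intro Min_in) (auto simp: lessThan_empty_iff)
    then obtain i where i: "i < k"
      "Min ((\<lambda>i. bip_ratio N w (S (2*i)) (S (2*i+1))) ` {..<k}) = bip_ratio N w (S (2*i)) (S (2*i+1))"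
      by auto
    have "S (2*i) \<subseteq> {..<N}" "S (2*i+1) \<subseteq> {..<N}" using S i(1) unfolding sub_bipartition_def by simp_all
    then show "Min ((\<lambda>i. bip_ratio N w (S (2*i)) (S (2*i+1))) ` {..<k})
        \<in> (\<lambda>(A, B). bip_ratio N w A B) ` (Pow {..<N} \<times> Pow {..<N})"
      unfolding i(2) by (intro image_eqI[of _ _ "(S (2*i), S (2*i+1))"]) auto
  qed
qed simp

lemma dual_cheeger_ge:
  assumes "1 \<le> k" "sub_bipartition N k S" "\<And>i. i < k \<Longrightarrow> M \<le> bip_ratio N w (S (2*i)) (S (2*i+1))"
  shows "M \<le> dual_cheeger N w k"
proof -
  have "M \<le> Min ((\<lambda>i. bip_ratio N w (S (2*i)) (S (2*i+1))) ` {..<k})"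
    using assms by (subst Min_ge_iff) (auto simp: lessThan_empty_iff)
  also have "\<dots> \<le> dual_cheeger N w k"
    unfolding dual_cheeger_def using assms(2) by (intro Max_ge dual_cheeger_finite[OF assms(1)]) blast
  finally show ?thesis .
qed

lemma dual_cheeger_attained:
  assumes "1 \<le> k" "k \<le> N"
  shows "\<exists>S. sub_bipartition N k S \<and> (\<forall>i<k. dual_cheeger N w k \<le> bip_ratio N w (S (2*i)) (S (2*i+1)))"
proof -
  let ?X = "{Min ((\<lambda>i. bip_ratio N w (S (2*i)) (S (2*i+1))) ` {..<k}) | S. sub_bipartition N k S}"
  \<comment> \<open>Pairing the singleton of \<open>i\<close> with the empty set, for each
    \<open>i < k\<close>, shows that the maximum is over a nonempty set; this is where
    \<open>k \<le> N\<close> enters.\<close>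
  have "sub_bipartition N k (\<lambda>p. if even p then {p div 2} else {})"
    using assms by (auto simp: sub_bipartition_def)
  then have "?X \<noteq> {}" by blast
  then have "dual_cheeger N w k \<in> ?X"
    unfolding dual_cheeger_def by (rule Max_in[OF dual_cheeger_finite[OF assms(1)]])
  then obtain S where S: "sub_bipartition N k S"
    "dual_cheeger N w k = Min ((\<lambda>i. bip_ratio N w (S (2*i)) (S (2*i+1))) ` {..<k})" by blast
  then show ?thesis by (intro exI[of _ S]) simp
qed

section \<open>Threshold sets\<close>

text \<open>Layer-cake argument: both sides of \<open>less\<close> are integrals over levels
  \<open>t\<close>, of the volume of the truncated pair minus its opposite-side weight and of
  \<open>\<rho>\<close> times that volume, so the strict inequality holds at some level.\<close>

lemma threshold_pair:
  assumes G: "wgraph N w" and A: "A \<subseteq> {..<N}" and B: "B \<subseteq> {..<N}" and disj: "A \<inter> B = {}"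
    and a: "\<And>u. u < N \<Longrightarrow> 0 \<le> a u"
    and less: "(\<Sum>u<N. \<Sum>v<N. w u v * (of_bool (u \<in> A \<union> B) * a u -
        of_bool (u \<in> A \<and> v \<in> B \<or> u \<in> B \<and> v \<in> A) * min (a u) (a v)))
      < \<rho> * (\<Sum>u<N. deg N w u * (of_bool (u \<in> A \<union> B) * a u))"
  shows "\<exists>t. {u\<in>A. t \<le> a u} \<union> {u\<in>B. t \<le> a u} \<noteq> {} \<and>
    1 - \<rho> < bip_ratio N w {u\<in>A. t \<le> a u} {u\<in>B. t \<le> a u}"
proof -
  let ?opp = "\<lambda>u v. of_bool (u \<in> A \<and> v \<in> B \<or> u \<in> B \<and> v \<in> A) :: real"
  let ?in = "\<lambda>u. of_bool (u \<in> A \<union> B) :: real"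
  \<comment> \<open>Any bound for all values of \<open>a\<close> serves as the upper end of the
    range of levels.\<close>
  define T where "T = (\<Sum>u<N. a u)"
  have T: "a u \<le> T" if "u < N" for u
    unfolding T_def using that a by (intro member_le_sum) auto
  define vt where "vt t = (\<Sum>u<N. deg N w u * (?in u * of_bool (t \<le> a u)))" for t
  define ct where "ct t = (\<Sum>u<N. \<Sum>v<N. w u v * (?in u * of_bool (t \<le> a u) -
      ?opp u v * of_bool (t \<le> min (a u) (a v))))" for t
  have "(vt has_integral (\<Sum>u<N. deg N w u * (?in u * a u))) {0..T}"
    unfolding vt_def using a T
    by (intro has_integral_sum has_integral_mult_right has_integral_indicator_le) auto
  then have vt_int: "((\<lambda>t. \<rho> * vt t) has_integral \<rho> * (\<Sum>u<N. deg N w u * (?in u * a u))) {0..T}"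
    by (rule has_integral_mult_right)
  have ct_int: "(ct has_integral
      (\<Sum>u<N. \<Sum>v<N. w u v * (?in u * a u - ?opp u v * min (a u) (a v)))) {0..T}"
    unfolding ct_def using a T
    by (intro has_integral_sum has_integral_mult_right has_integral_diff has_integral_indicator_le)
      (auto simp: min_le_iff_disj)
  have "\<exists>t. ct t < \<rho> * vt t"
  proof (rule ccontr)
    assume "\<not> ?thesis"
    then have "\<rho> * vt t \<le> ct t" for t by (meson not_le)
    then show False using has_integral_le[OF vt_int ct_int] less by simp
  qed
  then obtain t where t: "ct t < \<rho> * vt t" by blast
  define A' where "A' = {u\<in>A. t \<le> a u}"
  define B' where "B' = {u\<in>B. t \<le> a u}"
  have A': "A' \<subseteq> {..<N}" and B': "B' \<subseteq> {..<N}" and disj': "A' \<inter> B' = {}"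
    using A B disj by (auto simp: A'_def B'_def)
  have vt: "vt t = vol N w (A' \<union> B')"
  proof -
    have "vol N w (A' \<union> B') = (\<Sum>u<N. of_bool (u \<in> A' \<union> B') * deg N w u)"
      unfolding vol_def using A' B' by (intro sum_subset_of_bool) auto
    also have "\<dots> = vt t"
      unfolding vt_def by (intro sum.cong refl) (auto simp: A'_def B'_def of_bool_def)
    finally show ?thesis by simp
  qed
  have "ct t = (\<Sum>u<N. \<Sum>v<N. w u v * (?in u * of_bool (t \<le> a u)))
      - (\<Sum>u<N. \<Sum>v<N. w u v * (?opp u v * of_bool (t \<le> min (a u) (a v))))"
    unfolding ct_def by (simp only: right_diff_distrib sum_subtractf)
  also have "(\<Sum>u<N. \<Sum>v<N. w u v * (?in u * of_bool (t \<le> a u))) = vt t"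
    unfolding vt_def by (rule sum_deg[symmetric])
  also have "(\<Sum>u<N. \<Sum>v<N. w u v * (?opp u v * of_bool (t \<le> min (a u) (a v)))) =
      (\<Sum>u<N. \<Sum>v<N. w u v * of_bool (u \<in> A' \<and> v \<in> B' \<or> u \<in> B' \<and> v \<in> A'))"
    by (intro sum.cong refl arg_cong2[where f = "(*)"]) (auto simp: A'_def B'_def of_bool_def)
  also have "\<dots> = 2 * edges_between w A' B'" by (rule sum_opposite_sides[OF G A' B' disj'])
  finally have ct: "ct t = vol N w (A' \<union> B') - 2 * edges_between w A' B'" by (simp add: vt)
  \<comment> \<open>For empty sets \<open>ct t\<close> and \<open>vt t\<close> would both be 0,
    against the strict inequality.\<close>
  have ne: "A' \<union> B' \<noteq> {}"
  proof
    assume "A' \<union> B' = {}"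
    then show False using t ct vt by (simp add: vol_def edges_between_def)
  qed
  then have "vol N w (A' \<union> B') > 0" using A' B' by (intro vol_pos[OF G]) auto
  then have "1 - \<rho> < bip_ratio N w A' B'"
    using t unfolding ct vt bip_ratio_def by (simp add: field_simps)
  then show ?thesis using ne unfolding A'_def B'_def by blast
qed

section \<open>Inequalities between Euclidean norms\<close>

lemma L2_set_minus: "L2_set (\<lambda>j. - x j) I = L2_set x I"
  by (simp add: L2_set_def)

lemma abs_le_L2_set: "finite I \<Longrightarrow> j \<in> I \<Longrightarrow> \<bar>x j\<bar> \<le> L2_set x I"
  unfolding L2_set_def by (rule real_le_rsqrt) (auto intro: member_le_sum[of j I "\<lambda>j. (x j)\<^sup>2"])

lemma L2_set_diff_le: "\<bar>L2_set x I - L2_set y I\<bar> \<le> L2_set (\<lambda>j. x j + y j) I"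
proof -
  have "L2_set x I \<le> L2_set (\<lambda>j. x j + y j) I + L2_set y I" for x y
    using L2_set_triangle_ineq[of "\<lambda>j. x j + y j" "\<lambda>j. - y j" I] by (simp add: L2_set_minus)
  from this[of x y] this[of y x] show ?thesis by (simp add: add.commute abs_le_iff)
qed

text \<open>Passing to directions is Lipschitz after scaling by the norm: the sum of two directions
  is controlled by the sum of the vectors. A zero vector has direction 0 by the convention for
  division, and the bound still holds.\<close>

lemma L2_set_normalized_sum_le:
  assumes "finite I" "j \<in> I"
  shows "L2_set x I * \<bar>x j / L2_set x I + y j / L2_set y I\<bar> \<le> 2 * L2_set (\<lambda>j. x j + y j) I"
proof (cases "L2_set x I = 0")
  case False
  let ?z = "y j / L2_set y I"
  have y: "\<bar>y j\<bar> \<le> L2_set y I" by (rule abs_le_L2_set[OF assms])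
  then have z: "\<bar>?z\<bar> \<le> 1" by (cases "L2_set y I = 0") (auto simp: field_simps)
  have "L2_set y I * ?z = y j" using y by (cases "L2_set y I = 0") auto
  \<comment> \<open>The first summand is a coordinate of \<open>x + y\<close>; the second pays for
    replacing the norm of \<open>x\<close> by that of \<open>y\<close>.\<close>
  then have eq: "L2_set x I * (x j / L2_set x I + ?z) = (x j + y j) + (L2_set x I - L2_set y I) * ?z"
    using False by (simp add: algebra_simps)
  have "L2_set x I * \<bar>x j / L2_set x I + ?z\<bar> = \<bar>L2_set x I * (x j / L2_set x I + ?z)\<bar>"
    by (simp add: abs_mult)
  also have "\<dots> \<le> \<bar>x j + y j\<bar> + \<bar>L2_set x I - L2_set y I\<bar> * \<bar>?z\<bar>"
    unfolding eq abs_mult[symmetric] by (rule abs_triangle_ineq)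
  also have "\<dots> \<le> L2_set (\<lambda>j. x j + y j) I + L2_set (\<lambda>j. x j + y j) I * 1"
    by (intro add_mono mult_mono abs_le_L2_set[OF assms, of "\<lambda>j. x j + y j"] L2_set_diff_le z) auto
  finally show ?thesis by simp
qed simp

lemma L2_set_power2_diff_le:
  "\<bar>(L2_set x I)\<^sup>2 - (L2_set y I)\<^sup>2\<bar> \<le> L2_set (\<lambda>j. x j + y j) I * (L2_set x I + L2_set y I)"
proof -
  have "\<bar>(L2_set x I)\<^sup>2 - (L2_set y I)\<^sup>2\<bar> = \<bar>L2_set x I - L2_set y I\<bar> * (L2_set x I + L2_set y I)"
    by (simp add: power2_eq_square square_diff_square_factored abs_mult mult.commute)
  then show ?thesis by (simp add: L2_set_diff_le mult_right_mono)
qed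

lemma weighted_Cauchy_Schwarz:
  fixes w :: "nat \<Rightarrow> nat \<Rightarrow> real"
  assumes "\<And>u v. u < N \<Longrightarrow> v < N \<Longrightarrow> 0 \<le> w u v"
  shows "(\<Sum>u<N. \<Sum>v<N. w u v * (x u v * y u v)) \<le>
    sqrt (\<Sum>u<N. \<Sum>v<N. w u v * (x u v)\<^sup>2) * sqrt (\<Sum>u<N. \<Sum>v<N. w u v * (y u v)\<^sup>2)"
proof -
  let ?P = "{..<N} \<times> {..<N}"
  let ?x = "\<lambda>(u,v). sqrt (w u v) * x u v" and ?y = "\<lambda>(u,v). sqrt (w u v) * y u v"
  have "w u v * (x u v * y u v) = (sqrt (w u v) * x u v) * (sqrt (w u v) * y u v)" if "u < N" "v < N" for u v
  proof -
    have "w u v * (x u v * y u v) = (sqrt (w u v) * sqrt (w u v)) * (x u v * y u v)"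
      using assms[OF that] by simp
    then show ?thesis by (simp only: mult_ac)
  qed
  then have "(\<Sum>u<N. \<Sum>v<N. w u v * (x u v * y u v)) = (\<Sum>p\<in>?P. ?x p * ?y p)"
    unfolding sum.cartesian_product by (intro sum.cong refl) auto
  moreover have "(\<Sum>u<N. \<Sum>v<N. w u v * (x u v)\<^sup>2) = (\<Sum>p\<in>?P. (?x p)\<^sup>2)"
    "(\<Sum>u<N. \<Sum>v<N. w u v * (y u v)\<^sup>2) = (\<Sum>p\<in>?P. (?y p)\<^sup>2)"
    unfolding sum.cartesian_product using assms
    by (intro sum.cong refl; auto simp: power_mult_distrib)+
  moreover have "(\<Sum>p\<in>?P. ?x p * ?y p) \<le> sqrt ((\<Sum>p\<in>?P. (?x p)\<^sup>2) * (\<Sum>p\<in>?P. (?y p)\<^sup>2))"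
    by (rule real_le_rsqrt) (rule Cauchy_Schwarz_ineq_sum)
  ultimately show ?thesis by (simp add: real_sqrt_mult)
qed

section \<open>The spectral embedding\<close>

text \<open>An odd choice of sign, to tell a label from its antipode. On the zero function it is 0,
  whatever \<open>LEAST\<close> returns.\<close>

definition leading_sign :: "(nat \<Rightarrow> int) \<Rightarrow> int" where
  "leading_sign l = sgn (l (LEAST j. l j \<noteq> 0))"

lemma leading_sign_minus: "leading_sign (\<lambda>j. - l j) = - leading_sign l"
  by (simp add: leading_sign_def sgn_minus)

lemma leading_sign_cases:
  assumes "l j \<noteq> 0"
  shows "leading_sign l = 1 \<or> leading_sign l = - 1"
proof -
  have "l (LEAST j. l j \<noteq> 0) \<noteq> 0" using assms by (rule LeastI)
  then show ?thesis by (auto simp: leading_sign_def sgn_if)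
qed

text \<open>The embedding F sends \<open>v\<close> to the vector of the \<open>f j v\<close>,
  \<open>j < k\<close>. Below, \<open>r v\<close> is the norm of F v, \<open>p j v\<close> are the
  coordinates of its direction, and \<open>e u v\<close> is the norm of F u + F v.\<close>

locale spectral_embedding =
  fixes N :: nat and w :: "nat \<Rightarrow> nat \<Rightarrow> real" and k :: nat and f :: "nat \<Rightarrow> nat \<Rightarrow> real" and \<eta> :: real
  assumes G: "wgraph N w" and k: "1 \<le> k"
    and orth: "\<And>i j. i < k \<Longrightarrow> j < k \<Longrightarrow> wip N (deg N w) (f i) (f j) = (if i = j then 1 else 0)"
    and energy: "\<And>j. j < k \<Longrightarrow> bform N (signless N w) (f j) (f j) \<le> \<eta>"
begin

lemma w_nonneg: "u < N \<Longrightarrow> v < N \<Longrightarrow> 0 \<le> w u v"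
  using G unfolding wgraph_def by blast

definition r :: "nat \<Rightarrow> real" where
  "r v = L2_set (\<lambda>j. f j v) {..<k}"

definition p :: "nat \<Rightarrow> nat \<Rightarrow> real" where
  "p j v = f j v / r v"

definition e :: "nat \<Rightarrow> nat \<Rightarrow> real" where
  "e u v = L2_set (\<lambda>j. f j u + f j v) {..<k}"

text \<open>The factor \<open>4 * real k\<close> turns the unit grid into one of mesh
  \<open>1 / (4 * real k)\<close>. Padding with 0 from \<open>k\<close> on lets labels be compared
  as functions on all indices.\<close>

definition lab :: "real \<Rightarrow> nat \<Rightarrow> nat \<Rightarrow> int" where
  "lab s v j = (if j < k then grid_label s (4 * real k * p j v) else 0)"

lemma r_nonneg: "0 \<le> r v"
  by (simp add: r_def)

lemma r_sq: "(r v)\<^sup>2 = (\<Sum>j<k. (f j v)\<^sup>2)"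
  by (simp add: r_def L2_set_def sum_nonneg)

lemma e_sq: "(e u v)\<^sup>2 = (\<Sum>j<k. (f j u + f j v)\<^sup>2)"
  by (simp add: e_def L2_set_def sum_nonneg)

lemma p_sq: "r v \<noteq> 0 \<Longrightarrow> (\<Sum>j<k. (p j v)\<^sup>2) = 1"
  by (simp add: p_def power_divide sum_divide_distrib[symmetric] r_sq[symmetric])

lemma total_mass: "(\<Sum>v<N. deg N w v * (r v)\<^sup>2) = real k"
proof -
  have "(\<Sum>v<N. deg N w v * (r v)\<^sup>2) = (\<Sum>j<k. wip N (deg N w) (f j) (f j))"
    unfolding r_sq sum_distrib_left wip_def
    by (subst sum.swap) (simp add: power2_eq_square mult.assoc)
  then show ?thesis by (simp add: orth)
qed

text \<open>Parseval for the orthonormal \<open>f j\<close>: the embedding has second moment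
  \<open>|z|^2\<close> in every direction \<open>z\<close>.\<close>

lemma isotropy: "(\<Sum>v<N. deg N w v * (\<Sum>j<k. z j * f j v)\<^sup>2) = (\<Sum>j<k. (z j)\<^sup>2)"
proof -
  let ?F = "\<lambda>v. \<Sum>j<k. z j * f j v"
  have "wip N (deg N w) (f i) ?F = z i" if "i < k" for i
  proof -
    have "wip N (deg N w) (f i) ?F = (\<Sum>j<k. z j * wip N (deg N w) (f j) (f i))"
      by (subst wip_commute) (simp add: wip_sum_left wip_scale_left)
    also have "\<dots> = (\<Sum>j<k. if j = i then z j else 0)"
      using that by (intro sum.cong) (auto simp: orth)
    finally show ?thesis using that by simp
  qed
  then have "wip N (deg N w) ?F ?F = (\<Sum>j<k. (z j)\<^sup>2)"
    by (simp add: wip_sum_left wip_scale_left power2_eq_square)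
  then show ?thesis by (simp add: wip_def power2_eq_square mult.assoc)
qed

text \<open>All directions in \<open>R\<close> are, up to sign, close to that of one
  \<open>u\<close>, so the second moment along that direction captures almost the whole mass of
  \<open>R\<close>; by isotropy this moment is at most 1 in total.\<close>

lemma cell_mass_le:
  assumes R: "R \<subseteq> {..<N}" "\<And>v. v \<in> R \<Longrightarrow> r v \<noteq> 0"
    and close: "\<And>u v. u \<in> R \<Longrightarrow> v \<in> R \<Longrightarrow>
      \<exists>\<sigma>. \<sigma>\<^sup>2 = 1 \<and> (\<forall>j<k. \<bar>p j u - \<sigma> * p j v\<bar> \<le> 1 / (2 * real k))"
  shows "(\<Sum>v\<in>R. deg N w v * (r v)\<^sup>2) \<le> 1 + 1 / (2 * real k)"
proof (cases "R = {}")
  case False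
  then obtain u where u: "u \<in> R" by blast
  have corr: "1 - 1 / (4 * real k) \<le> (\<Sum>j<k. p j u * p j v)\<^sup>2" if v: "v \<in> R" for v
  proof -
    obtain \<sigma> where \<sigma>: "\<sigma>\<^sup>2 = 1" "\<And>j. j < k \<Longrightarrow> \<bar>p j u - \<sigma> * p j v\<bar> \<le> 1 / (2 * real k)"
      using close[OF u v] by blast
    let ?c = "\<sigma> * (\<Sum>j<k. p j u * p j v)"
    \<comment> \<open>Squared distance of two unit vectors, summed over \<open>k\<close> coordinates
      that each contribute at most \<open>(1 / (2 * real k))^2\<close>.\<close>
    have "2 - 2 * ?c = (\<Sum>j<k. (p j u)\<^sup>2) + \<sigma>\<^sup>2 * (\<Sum>j<k. (p j v)\<^sup>2) - 2 * ?c"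
      using u v R(2) by (simp add: p_sq \<sigma>(1))
    also have "\<dots> = (\<Sum>j<k. (p j u - \<sigma> * p j v)\<^sup>2)"
      by (simp add: power2_diff power_mult_distrib sum.distrib sum_subtractf sum_distrib_left mult_ac)
    also have "\<dots> \<le> (\<Sum>j<k. (1 / (2 * real k))\<^sup>2)"
      using \<sigma>(2) k by (intro sum_mono) (simp add: abs_le_square_iff[symmetric])
    also have "\<dots> = 1 / (4 * real k)" using k by (simp add: power2_eq_square field_simps)
    finally have c: "1 - 1 / (4 * real k) / 2 \<le> ?c" by simp
    have "1 / (4 * real k) \<le> 1" using k by (simp add: field_simps)
    then have "0 \<le> 1 - 1 / (4 * real k) / 2" by simp
    from power_mono[OF c this, of 2]
    have "(1 - 1 / (4 * real k) / 2)\<^sup>2 \<le> (\<Sum>j<k. p j u * p j v)\<^sup>2"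
      by (simp add: power_mult_distrib \<sigma>(1))
    moreover have "1 - 1 / (4 * real k) \<le> (1 - 1 / (4 * real k) / 2)\<^sup>2"
      using zero_le_power2[of "1 / (4 * real k) / 2"] by (simp add: power2_diff)
    ultimately show ?thesis by linarith
  qed
  let ?M = "\<Sum>v\<in>R. deg N w v * (r v)\<^sup>2"
  have "?M * (1 - 1 / (4 * real k)) \<le> (\<Sum>v\<in>R. deg N w v * (\<Sum>j<k. p j u * f j v)\<^sup>2)"
    unfolding sum_distrib_right
  proof (intro sum_mono)
    fix v assume v: "v \<in> R"
    have d: "0 \<le> deg N w v * (r v)\<^sup>2" using deg_pos[OF G, of v] v R(1) by (auto simp: less_imp_le)
    have "(\<Sum>j<k. p j u * f j v) = r v * (\<Sum>j<k. p j u * p j v)"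
      unfolding sum_distrib_left using R(2)[OF v] by (intro sum.cong) (auto simp: p_def)
    then have "deg N w v * (\<Sum>j<k. p j u * f j v)\<^sup>2 = deg N w v * (r v)\<^sup>2 * (\<Sum>j<k. p j u * p j v)\<^sup>2"
      by (simp add: power_mult_distrib)
    then show "deg N w v * (r v)\<^sup>2 * (1 - 1 / (4 * real k)) \<le> deg N w v * (\<Sum>j<k. p j u * f j v)\<^sup>2"
      using mult_left_mono[OF corr[OF v] d] by (simp only:)
  qed
  also have "\<dots> \<le> (\<Sum>v<N. deg N w v * (\<Sum>j<k. p j u * f j v)\<^sup>2)"
    using R(1) by (intro sum_mono2) (auto intro!: mult_nonneg_nonneg less_imp_le[OF deg_pos[OF G]])
  also have "\<dots> = 1" using isotropy[of "\<lambda>j. p j u"] p_sq R(2)[OF u] by simp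
  finally have M: "?M * (1 - 1 / (4 * real k)) \<le> 1" .
  have pos: "0 < 1 - 1 / (4 * real k)" using k by (simp add: field_simps)
  \<comment> \<open>The bound \<open>1 + 1 / (2 * real k)\<close> exceeds the reciprocal of
    \<open>1 - 1 / (4 * real k)\<close>.\<close>
  have "1 \<le> (1 + 1 / (2 * real k)) * (1 - 1 / (4 * real k))"
    using k by (simp add: field_simps)
  then show ?thesis using M pos by (meson mult_le_cancel_right_pos order_trans)
qed simp

section \<open>Expected cost of a random cut\<close>

lemma sum_weighted_energy: "(\<Sum>u<N. \<Sum>v<N. w u v * (r u * e u v)) \<le> sqrt 2 * real k * sqrt \<eta>"
proof -
  have "(\<Sum>u<N. \<Sum>v<N. w u v * (e u v)\<^sup>2) = (\<Sum>u<N. \<Sum>j<k. \<Sum>v<N. w u v * (f j u + f j v)\<^sup>2)"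
    unfolding e_sq sum_distrib_left by (intro sum.cong refl sum.swap)
  also have "\<dots> = (\<Sum>j<k. \<Sum>u<N. \<Sum>v<N. w u v * (f j u + f j v)\<^sup>2)" by (rule sum.swap)
  also have "\<dots> = (\<Sum>j<k. 2 * bform N (signless N w) (f j) (f j))"
    by (simp only: bform_signless_diag[OF G])
  also have "\<dots> \<le> (\<Sum>j<k. 2 * \<eta>)" using energy by (intro sum_mono) simp
  finally have E: "(\<Sum>u<N. \<Sum>v<N. w u v * (e u v)\<^sup>2) \<le> 2 * real k * \<eta>" by simp
  have "(\<Sum>u<N. \<Sum>v<N. w u v * (r u * e u v)) \<le>
      sqrt (\<Sum>u<N. \<Sum>v<N. w u v * (r u)\<^sup>2) * sqrt (\<Sum>u<N. \<Sum>v<N. w u v * (e u v)\<^sup>2)"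
    by (rule weighted_Cauchy_Schwarz[OF w_nonneg])
  also have "(\<Sum>u<N. \<Sum>v<N. w u v * (r u)\<^sup>2) = real k"
    by (simp only: sum_deg[symmetric] total_mass)
  also have "sqrt (real k) * sqrt (\<Sum>u<N. \<Sum>v<N. w u v * (e u v)\<^sup>2) \<le> sqrt (real k) * sqrt (2 * real k * \<eta>)"
    using E by (intro mult_left_mono) auto
  also have "\<dots> = sqrt 2 * (sqrt (real k) * sqrt (real k)) * sqrt \<eta>"
    by (simp only: real_sqrt_mult mult_ac)
  finally show ?thesis by simp
qed

text \<open>A bound, common to all regions, for the weight lost at shift \<open>s\<close>. The first
  summand pays for truncation between opposite halves; the second pays for pairs whose labels are
  not antipodal, where the integer sum over \<open>j\<close> is at least 1.\<close>

definition cut_cost :: "real \<Rightarrow> real" where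
  "cut_cost s = (\<Sum>u<N. \<Sum>v<N. w u v * (\<bar>(r u)\<^sup>2 - (r v)\<^sup>2\<bar> +
     (r u)\<^sup>2 * (\<Sum>j<k. \<bar>real_of_int (lab s u j + lab s v j)\<bar>)))"

definition mean_cut_cost :: real where
  "mean_cut_cost = (\<Sum>u<N. \<Sum>v<N. w u v * (\<bar>(r u)\<^sup>2 - (r v)\<^sup>2\<bar> +
     (r u)\<^sup>2 * (\<Sum>j<k. \<bar>4 * real k * p j u + 4 * real k * p j v\<bar>)))"

lemma has_integral_cut_cost: "(cut_cost has_integral mean_cut_cost) {0..1}"
proof -
  have const: "((\<lambda>s. c) has_integral c) {0..1::real}" for c :: real
    using has_integral_const_real[of c 0 1] by simp
  have "((\<lambda>s. \<bar>real_of_int (lab s u j + lab s v j)\<bar>) has_integral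
      \<bar>4 * real k * p j u + 4 * real k * p j v\<bar>) {0..1}" if "j \<in> {..<k}" for u v j
    using that has_integral_grid_label_dist[of "4 * real k * p j u" "4 * real k * p j v"]
    by (simp add: lab_def)
  then show ?thesis
    unfolding cut_cost_def[abs_def] mean_cut_cost_def
    by (intro has_integral_sum has_integral_mult_right has_integral_add const) auto
qed

text \<open>Both summands reduce to \<open>r u * e u v\<close>: the first through the difference of
  squared norms, the second with factor \<open>8 k^2\<close> from \<open>k\<close> coordinates, grid
  scale \<open>4 k\<close> and Lipschitz constant 2. Cauchy-Schwarz supplies the third power of
  \<open>k\<close> and \<open>sqrt \<eta>\<close>.\<close>

lemma mean_cut_cost_le: "mean_cut_cost \<le> 15 * real k ^ 3 * sqrt \<eta>"
proof -
  let ?W = "\<Sum>u<N. \<Sum>v<N. w u v * (r u * e u v)"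
  have e_sym: "e u v = e v u" for u v by (simp add: e_def add.commute)
  have W': "(\<Sum>u<N. \<Sum>v<N. w u v * (r v * e u v)) = ?W"
  proof (subst sum.swap, intro sum.cong refl)
    fix u v assume "u \<in> {..<N}" "v \<in> {..<N}"
    then have "w u v = w v u" using G unfolding wgraph_def by blast
    then show "w v u * (r u * e v u) = w u v * (r u * e u v)" by (simp add: e_sym[of u v])
  qed
  have "mean_cut_cost \<le> (\<Sum>u<N. \<Sum>v<N. w u v * (e u v * (r u + r v) + 8 * (real k)\<^sup>2 * (r u * e u v)))"
    unfolding mean_cut_cost_def
  proof (intro sum_mono mult_left_mono add_mono)
    fix u v
    show "\<bar>(r u)\<^sup>2 - (r v)\<^sup>2\<bar> \<le> e u v * (r u + r v)"
      unfolding r_def e_def by (rule L2_set_power2_diff_le)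
    have "r u * \<bar>4 * real k * p j u + 4 * real k * p j v\<bar> \<le> 8 * real k * e u v" if "j < k" for j
    proof -
      have "r u * \<bar>p j u + p j v\<bar> \<le> 2 * e u v"
        using L2_set_normalized_sum_le[of "{..<k}" j "\<lambda>j. f j u" "\<lambda>j. f j v"] that
        by (simp add: p_def r_def e_def)
      then have "4 * real k * (r u * \<bar>p j u + p j v\<bar>) \<le> 4 * real k * (2 * e u v)"
        by (intro mult_left_mono) auto
      moreover have "4 * real k * p j u + 4 * real k * p j v = 4 * real k * (p j u + p j v)"
        by (simp only: distrib_left)
      then have "r u * \<bar>4 * real k * p j u + 4 * real k * p j v\<bar> = 4 * real k * (r u * \<bar>p j u + p j v\<bar>)"
        by (simp only: abs_mult) simp
      ultimately show ?thesis by linarith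
    qed
    then have "(\<Sum>j<k. r u * \<bar>4 * real k * p j u + 4 * real k * p j v\<bar>) \<le> (\<Sum>j<k. 8 * real k * e u v)"
      by (intro sum_mono) simp
    then have "r u * (\<Sum>j<k. \<bar>4 * real k * p j u + 4 * real k * p j v\<bar>) \<le> 8 * (real k)\<^sup>2 * e u v"
      by (simp add: sum_distrib_left power2_eq_square mult_ac)
    from mult_left_mono[OF this r_nonneg[of u]]
    show "(r u)\<^sup>2 * (\<Sum>j<k. \<bar>4 * real k * p j u + 4 * real k * p j v\<bar>) \<le> 8 * (real k)\<^sup>2 * (r u * e u v)"
      by (simp add: power2_eq_square mult_ac)
  qed (simp add: w_nonneg)
  also have "\<dots> = ?W + (\<Sum>u<N. \<Sum>v<N. w u v * (r v * e u v)) + 8 * (real k)\<^sup>2 * ?W"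
    by (simp add: sum_distrib_left sum.distrib algebra_simps)
  also have "\<dots> = (2 + 8 * (real k)\<^sup>2) * ?W" unfolding W' by (simp add: algebra_simps)
  also have "\<dots> \<le> (10 * (real k)\<^sup>2) * (sqrt 2 * real k * sqrt \<eta>)"
  proof (intro mult_mono sum_weighted_energy)
    show "2 + 8 * (real k)\<^sup>2 \<le> 10 * (real k)\<^sup>2" using k by (simp add: one_le_power)
    show "0 \<le> ?W" by (intro sum_nonneg mult_nonneg_nonneg) (auto simp: w_nonneg r_nonneg e_def)
  qed simp
  also have "\<dots> = (10 * sqrt 2) * (real k ^ 3 * sqrt \<eta>)" by (simp add: power2_eq_square power3_eq_cube)
  also have "\<dots> \<le> 15 * (real k ^ 3 * sqrt \<eta>)"
  proof (rule mult_right_mono)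
    have "sqrt 2 \<le> 3/2" by (rule real_le_lsqrt) (auto simp: power2_eq_square)
    then show "10 * sqrt 2 \<le> (15::real)" by simp
    have "0 \<le> bform N (signless N w) (f 0) (f 0)" by (rule bform_signless_nonneg[OF G])
    also have "\<dots> \<le> \<eta>" using energy k by simp
    finally show "0 \<le> real k ^ 3 * sqrt \<eta>" by simp
  qed
  finally show ?thesis by simp
qed

lemma good_shift_exists:
  assumes "15 * real k ^ 3 * sqrt \<eta> < c"
  shows "\<exists>s\<in>{0..1}. cut_cost s < c"
proof (rule ccontr)
  assume "\<not> ?thesis"
  then have "c \<le> cut_cost s" if "s \<in> {0..1}" for s using that by force
  moreover have "((\<lambda>s. c) has_integral c) {0..1::real}"
    using has_integral_const_real[of c 0 1] by simp
  ultimately have "c \<le> mean_cut_cost" using has_integral_le has_integral_cut_cost by blast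
  then show False using mean_cut_cost_le assms by simp
qed

section \<open>Cells, sides and regions\<close>

lemma lab_nonzero:
  assumes "r v \<noteq> 0" "0 \<le> s" "s \<le> 1"
  shows "\<exists>j. lab s v j \<noteq> 0"
proof (rule ccontr)
  assume "\<not> ?thesis"
  then have zero: "lab s v j = 0" for j by blast
  \<comment> \<open>If all labels were 0, every coordinate of a unit vector would be at most
    \<open>1 / (4 * real k)\<close>, too small for the squares to sum to 1.\<close>
  have small: "\<bar>p j v\<bar> \<le> 1 / (4 * real k)" if "j < k" for j
  proof -
    have "grid_label s (4 * real k * p j v) = 0" using zero[of j] that by (simp add: lab_def)
    then have "\<bar>4 * real k * p j v\<bar> \<le> 1" using grid_label_eq_0_imp assms by blast
    then show ?thesis using k by (simp add: abs_mult field_simps)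
  qed
  have "1 = (\<Sum>j<k. (p j v)\<^sup>2)" using p_sq assms by simp
  also have "\<dots> \<le> (\<Sum>j<k. (1 / (4 * real k))\<^sup>2)"
    using small k by (intro sum_mono) (simp add: abs_le_square_iff[symmetric])
  also have "\<dots> = 1 / (16 * real k)" using k by (simp add: power2_eq_square field_simps)
  also have "\<dots> < 1" using k by (simp add: field_simps)
  finally show False by simp
qed

lemma lab_eq_0: "r v = 0 \<Longrightarrow> lab s v j = 0"
  by (simp add: lab_def p_def)

lemma lab_close:
  assumes "\<sigma> = 1 \<or> \<sigma> = - 1" "\<And>j. lab s u j = \<sigma> * lab s v j" "0 \<le> s" "s \<le> 1" "j < k"
  shows "\<bar>p j u - real_of_int \<sigma> * p j v\<bar> \<le> 1 / (2 * real k)"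
proof -
  have "grid_label s (4 * real k * p j u) = grid_label s (4 * real k * (real_of_int \<sigma> * p j v))"
    using assms(1) assms(2)[of j] \<open>j < k\<close> by (auto simp: lab_def grid_label_minus)
  then have "\<bar>4 * real k * p j u - 4 * real k * (real_of_int \<sigma> * p j v)\<bar> \<le> 2"
    using grid_label_eq_imp assms(3,4) by blast
  then have "4 * real k * \<bar>p j u - real_of_int \<sigma> * p j v\<bar> \<le> 2"
    by (simp add: right_diff_distrib[symmetric] abs_mult)
  then show ?thesis using k by (simp add: field_simps)
qed

definition side :: "real \<Rightarrow> nat \<Rightarrow> int" where
  "side s v = leading_sign (lab s v)"

text \<open>Antipodal labels give the same \<open>cell\<close> with opposite \<open>side\<close>.\<close>

definition cell :: "real \<Rightarrow> nat \<Rightarrow> nat \<Rightarrow> int" where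
  "cell s v = (\<lambda>j. side s v * lab s v j)"

lemma side_cases:
  assumes "r v \<noteq> 0" "0 \<le> s" "s \<le> 1"
  shows "side s v = 1 \<or> side s v = - 1"
  using lab_nonzero[OF assms] leading_sign_cases unfolding side_def by blast

lemma opposite_lab:
  assumes "\<And>j. lab s v j = - lab s u j"
  shows "side s v = - side s u" "cell s v = cell s u"
proof -
  have "lab s v = (\<lambda>j. - lab s u j)" using assms by blast
  then show "side s v = - side s u" by (simp add: side_def leading_sign_minus)
  then show "cell s v = cell s u" using assms by (simp add: cell_def)
qed

lemma cell_eq_mass_le:
  assumes s: "0 \<le> s" "s \<le> 1"
  shows "(\<Sum>v | v < N \<and> r v \<noteq> 0 \<and> cell s v = c. deg N w v * (r v)\<^sup>2) \<le> 1 + 1 / (2 * real k)"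
proof (rule cell_mass_le)
  fix u v
  assume "u \<in> {v. v < N \<and> r v \<noteq> 0 \<and> cell s v = c}" "v \<in> {v. v < N \<and> r v \<noteq> 0 \<and> cell s v = c}"
  then have uv: "r u \<noteq> 0" "r v \<noteq> 0" "cell s u = cell s v" by auto
  \<comment> \<open>Equal cells mean labels equal up to this sign, hence directions close up to the
    same sign.\<close>
  define \<sigma> where "\<sigma> = side s u * side s v"
  have cases: "\<sigma> = 1 \<or> \<sigma> = - 1"
    using side_cases[OF uv(1) s] side_cases[OF uv(2) s] by (auto simp: \<sigma>_def)
  have "lab s u j = \<sigma> * lab s v j" for j
    using fun_cong[OF uv(3), of j] side_cases[OF uv(1) s] by (auto simp: cell_def \<sigma>_def)
  then have "\<forall>j<k. \<bar>p j u - real_of_int \<sigma> * p j v\<bar> \<le> 1 / (2 * real k)"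
    using lab_close[OF cases _ s] by blast
  moreover have "(real_of_int \<sigma>)\<^sup>2 = 1" using cases by auto
  ultimately show "\<exists>\<sigma>. \<sigma>\<^sup>2 = 1 \<and> (\<forall>j<k. \<bar>p j u - \<sigma> * p j v\<bar> \<le> 1 / (2 * real k))" by blast
qed auto

lemma region_cut_le:
  assumes s: "0 \<le> s" "s \<le> 1"
  defines "V \<equiv> {v. v < N \<and> r v \<noteq> 0}"
  assumes A: "A = {v\<in>V. cell s v \<in> X \<and> side s v = 1}"
    and B: "B = {v\<in>V. cell s v \<in> X \<and> side s v = - 1}"
  shows "(\<Sum>u<N. \<Sum>v<N. w u v * (of_bool (u \<in> A \<union> B) * (r u)\<^sup>2 -
      of_bool (u \<in> A \<and> v \<in> B \<or> u \<in> B \<and> v \<in> A) * min ((r u)\<^sup>2) ((r v)\<^sup>2))) \<le> cut_cost s"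
  unfolding cut_cost_def
proof (intro sum_mono mult_left_mono)
  fix u v assume "u \<in> {..<N}" "v \<in> {..<N}"
  then have N: "u < N" "v < N" by auto
  then show "0 \<le> w u v" by (rule w_nonneg)
  let ?D = "\<Sum>j<k. \<bar>real_of_int (lab s u j + lab s v j)\<bar>"
  let ?opp = "u \<in> A \<and> v \<in> B \<or> u \<in> B \<and> v \<in> A"
  have D: "0 \<le> ?D" by (simp add: sum_nonneg)
  then have rhs: "0 \<le> (r u)\<^sup>2 * ?D" by simp
  show "of_bool (u \<in> A \<union> B) * (r u)\<^sup>2 - of_bool ?opp * min ((r u)\<^sup>2) ((r v)\<^sup>2) \<le>
      \<bar>(r u)\<^sup>2 - (r v)\<^sup>2\<bar> + (r u)\<^sup>2 * ?D"
  \<comment> \<open>For opposite \<open>u\<close>, \<open>v\<close> the loss is at most the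
    difference of the squared norms; for \<open>u\<close> outside the region there is none.
    Otherwise the full \<open>(r u)^2\<close> is lost.\<close>
  proof (cases "?opp \<or> u \<notin> A \<union> B")
    case True
    then show ?thesis using rhs by (auto simp: min_def)
  next
    case False
    \<comment> \<open>If every integer summand were 0, the labels would be antipodal, and
      \<open>v\<close> would lie in the same cell as \<open>u\<close> on the opposite side.\<close>
    have "1 \<le> ?D"
    proof (rule ccontr)
      assume small: "\<not> ?thesis"
      have opp: "lab s v j = - lab s u j" for j
      proof (cases "j < k")
        case True
        then have "\<bar>real_of_int (lab s u j + lab s v j)\<bar> \<le> ?D"
          by (intro member_le_sum[of j "{..<k}"]) auto
        then have "\<bar>real_of_int (lab s u j + lab s v j)\<bar> < 1" using small by simp
        then show ?thesis by linarith
      qed (simp add: lab_def)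
      have u: "r u \<noteq> 0" "cell s u \<in> X" "side s u = 1 \<longleftrightarrow> u \<in> A" "side s u = - 1 \<longleftrightarrow> u \<in> B"
        using False by (auto simp: A B V_def)
      have "r v \<noteq> 0"
        using lab_nonzero[OF u(1) s] opp lab_eq_0[of v s] by (metis neg_equal_0_iff_equal)
      then have "side s v = 1 \<longleftrightarrow> v \<in> A" "side s v = - 1 \<longleftrightarrow> v \<in> B"
        using opposite_lab(2)[OF opp] u(2) N by (auto simp: A B V_def)
      then show False using False opposite_lab(1)[OF opp] u(3,4) by auto
    qed
    then have "(r u)\<^sup>2 * 1 \<le> (r u)\<^sup>2 * ?D" by (rule mult_left_mono) simp
    then show ?thesis using False by auto
  qed
qed

lemma disjoint_regions_exist:
  assumes s: "0 \<le> s" "s \<le> 1"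
  defines "V \<equiv> {v. v < N \<and> r v \<noteq> 0}"
  shows "\<exists>X. (\<forall>i<k. 1/2 \<le> (\<Sum>v | v \<in> V \<and> cell s v \<in> X i. deg N w v * (r v)\<^sup>2)) \<and>
    (\<forall>i<k. \<forall>j<k. i \<noteq> j \<longrightarrow> X i \<inter> X j = {})"
proof -
  define m where "m c = (\<Sum>v | v \<in> V \<and> cell s v = c. deg N w v * (r v)\<^sup>2)" for c
  have fin: "finite V" by (simp add: V_def)
  \<comment> \<open>Regrouping by cells moves the problem from vertices to cells, so that no cell is
    split between regions.\<close>
  have sum_m: "sum m X = (\<Sum>v | v \<in> V \<and> cell s v \<in> X. deg N w v * (r v)\<^sup>2)"
    if "X \<subseteq> cell s ` V" for X
  proof -
    have "finite X" using that fin finite_subset by blast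
    moreover have "{v \<in> {v. v \<in> V \<and> cell s v \<in> X}. cell s v = c} = {v. v \<in> V \<and> cell s v = c}"
      if "c \<in> X" for c using that by auto
    ultimately show ?thesis
      using sum.group[of "{v. v \<in> V \<and> cell s v \<in> X}" X "cell s" "\<lambda>v. deg N w v * (r v)\<^sup>2"] fin
      unfolding m_def by (auto cong: sum.cong)
  qed
  have "(\<Sum>v | v \<in> V \<and> cell s v \<in> cell s ` V. deg N w v * (r v)\<^sup>2) = (\<Sum>v<N. deg N w v * (r v)\<^sup>2)"
    by (intro sum.mono_neutral_left) (auto simp: V_def)
  then have total: "sum m (cell s ` V) = real k" using sum_m total_mass by simp
  obtain X where X: "\<forall>i<k. X i \<subseteq> cell s ` V \<and> 1/2 \<le> sum m (X i)"
    "\<forall>i<k. \<forall>j<k. i \<noteq> j \<longrightarrow> X i \<inter> X j = {}"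
  proof -
    have "\<exists>X. (\<forall>i<k. X i \<subseteq> cell s ` V \<and> 1/2 \<le> sum m (X i)) \<and> (\<forall>i<k. \<forall>j<k. i \<noteq> j \<longrightarrow> X i \<inter> X j = {})"
    proof (rule disjoint_subsets_of_large_sum)
      show "m c \<le> 1 + 1 / (2 * real k)" for c
        using cell_eq_mass_le[OF s, of c] by (simp add: m_def V_def conj_assoc)
      \<comment> \<open>The left side is \<open>k + 1\<close> and the right side
        \<open>k + 1 + 1 / (2 k)\<close>: the cell bound is just fine enough for \<open>k\<close>
        regions of mass 1/2.\<close>
      show "real k * (1 + 1 / (2 * real k)) + 1/2 \<le> sum m (cell s ` V) + (1 + 1 / (2 * real k))"
        using k by (simp add: total field_simps)
    qed (use fin in auto)
    then show thesis using that by blast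
  qed
  have "1/2 \<le> (\<Sum>v | v \<in> V \<and> cell s v \<in> X i. deg N w v * (r v)\<^sup>2)" if "i < k" for i
  proof -
    have "X i \<subseteq> cell s ` V" "1/2 \<le> sum m (X i)" using X(1) that by auto
    then show ?thesis by (simp only: sum_m)
  qed
  then have "\<forall>i<k. 1/2 \<le> (\<Sum>v | v \<in> V \<and> cell s v \<in> X i. deg N w v * (r v)\<^sup>2)" by blast
  with X(2) show ?thesis by (intro exI[of _ X] conjI)
qed

lemma sub_bipartition_exists:
  assumes \<rho>: "30 * real k ^ 3 * sqrt \<eta> < \<rho>"
  shows "\<exists>S. sub_bipartition N k S \<and> (\<forall>i<k. 1 - \<rho> \<le> bip_ratio N w (S (2*i)) (S (2*i+1)))"
proof -
  \<comment> \<open>A single shift serves all regions. Since each region has mass at least 1/2, cost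
    below \<open>\<rho> / 2\<close> is below \<open>\<rho>\<close> times its mass; this doubles the
    constant 15 to 30.\<close>
  obtain s where s: "0 \<le> s" "s \<le> 1" "cut_cost s < \<rho> / 2"
    using good_shift_exists[of "\<rho> / 2"] \<rho> by auto
  define V where "V = {v. v < N \<and> r v \<noteq> 0}"
  obtain X where X: "\<forall>i<k. 1/2 \<le> (\<Sum>v | v \<in> V \<and> cell s v \<in> X i. deg N w v * (r v)\<^sup>2)"
    and X_disj: "\<forall>i<k. \<forall>j<k. i \<noteq> j \<longrightarrow> X i \<inter> X j = {}"
    using disjoint_regions_exist[OF s(1,2)] unfolding V_def by blast
  define A where "A i = {v\<in>V. cell s v \<in> X i \<and> side s v = 1}" for i
  define B where "B i = {v\<in>V. cell s v \<in> X i \<and> side s v = - 1}" for i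
  have AB: "A i \<subseteq> {..<N}" "B i \<subseteq> {..<N}" "A i \<inter> B i = {}" for i by (auto simp: A_def B_def V_def)
  have "\<exists>t. {u\<in>A i. t \<le> (r u)\<^sup>2} \<union> {u\<in>B i. t \<le> (r u)\<^sup>2} \<noteq> {} \<and>
      1 - \<rho> < bip_ratio N w {u\<in>A i. t \<le> (r u)\<^sup>2} {u\<in>B i. t \<le> (r u)\<^sup>2}" if i: "i < k" for i
  proof (rule threshold_pair[OF G AB])
    let ?M = "\<Sum>u<N. deg N w u * (of_bool (u \<in> A i \<union> B i) * (r u)\<^sup>2)"
    have "{v. v \<in> V \<and> cell s v \<in> X i} = A i \<union> B i"
      using side_cases s by (auto simp: A_def B_def V_def)
    then have "1/2 \<le> (\<Sum>v\<in>A i \<union> B i. deg N w v * (r v)\<^sup>2)" using X i by metis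
    also have "\<dots> = (\<Sum>u<N. of_bool (u \<in> A i \<union> B i) * (deg N w u * (r u)\<^sup>2))"
      using AB by (intro sum_subset_of_bool) auto
    also have "\<dots> = ?M" by (intro sum.cong refl) (simp only: mult_ac)
    finally have M: "1/2 \<le> ?M" .
    have "0 \<le> \<eta>" using energy[of 0] k bform_signless_nonneg[OF G, of "f 0"] by simp
    then have "0 \<le> 30 * real k ^ 3 * sqrt \<eta>" by simp
    then have "0 \<le> \<rho>" using \<rho> by linarith
    then have "\<rho> * (1/2) \<le> \<rho> * ?M" using M by (intro mult_left_mono)
    then show "(\<Sum>u<N. \<Sum>v<N. w u v * (of_bool (u \<in> A i \<union> B i) * (r u)\<^sup>2 -
        of_bool (u \<in> A i \<and> v \<in> B i \<or> u \<in> B i \<and> v \<in> A i) * min ((r u)\<^sup>2) ((r v)\<^sup>2))) < \<rho> * ?M"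
      using region_cut_le[OF s(1,2) A_def[of i, unfolded V_def] B_def[of i, unfolded V_def]] s(3) by linarith
  qed simp
  then have "\<forall>i\<in>{..<k}. \<exists>t. {u\<in>A i. t \<le> (r u)\<^sup>2} \<union> {u\<in>B i. t \<le> (r u)\<^sup>2} \<noteq> {} \<and>
      1 - \<rho> < bip_ratio N w {u\<in>A i. t \<le> (r u)\<^sup>2} {u\<in>B i. t \<le> (r u)\<^sup>2}" by simp
  from bchoice[OF this] obtain t where "\<forall>i\<in>{..<k}.
      {u\<in>A i. t i \<le> (r u)\<^sup>2} \<union> {u\<in>B i. t i \<le> (r u)\<^sup>2} \<noteq> {} \<and>
      1 - \<rho> < bip_ratio N w {u\<in>A i. t i \<le> (r u)\<^sup>2} {u\<in>B i. t i \<le> (r u)\<^sup>2}" by blast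
  then have t: "{u\<in>A i. t i \<le> (r u)\<^sup>2} \<union> {u\<in>B i. t i \<le> (r u)\<^sup>2} \<noteq> {}"
    "1 - \<rho> < bip_ratio N w {u\<in>A i. t i \<le> (r u)\<^sup>2} {u\<in>B i. t i \<le> (r u)\<^sup>2}" if "i < k" for i
    using that by simp_all
  define S where "S q = {u. (if even q then u \<in> A (q div 2) else u \<in> B (q div 2)) \<and> t (q div 2) \<le> (r u)\<^sup>2}" for q
  have S2: "S (2*i) = {u\<in>A i. t i \<le> (r u)\<^sup>2}" "S (2*i+1) = {u\<in>B i. t i \<le> (r u)\<^sup>2}" for i
    by (auto simp: S_def)
  have "sub_bipartition N k S"
    unfolding sub_bipartition_def
  proof (intro conjI allI impI)
    show "S q \<subseteq> {..<N}" if "q < 2 * k" for q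
      using AB(1,2)[of "q div 2"] by (auto simp: S_def split: if_splits)
    show "S (2*i) \<union> S (2*i+1) \<noteq> {}" if "i < k" for i
      using t(1)[OF that] unfolding S2 .
    show "S q \<inter> S q' = {}" if q: "q < 2 * k" "q' < 2 * k" "q \<noteq> q'" for q q'
    \<comment> \<open>Within one pair the sides differ; different pairs use disjoint sets of
      cells.\<close>
    proof (cases "q div 2 = q' div 2")
      case True
      then have "even q \<longleftrightarrow> odd q'" using q(3) by presburger
      then show ?thesis using True AB(3)[of "q div 2"] unfolding S_def by (auto split: if_splits)
    next
      case False
      have "q div 2 < k" "q' div 2 < k" using q by auto
      then have "X (q div 2) \<inter> X (q' div 2) = {}" using X_disj False by blast
      then show ?thesis unfolding S_def A_def B_def by (auto split: if_splits)
    qed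
  qed
  moreover have "1 - \<rho> \<le> bip_ratio N w (S (2*i)) (S (2*i+1))" if "i < k" for i
    using t(2)[OF that] unfolding S2 by simp
  ultimately show ?thesis by blast
qed

end

section \<open>Both inequalities for the eigenvalue and the dual Cheeger constant\<close>

theorem theorem1p2:
  shows "\<exists>C::real. C > 0 \<and>
    (\<forall>(N::nat) (w::nat \<Rightarrow> nat \<Rightarrow> real) (k::nat).
       wgraph N w \<and> 1 \<le> k \<and> k \<le> N \<longrightarrow>
         (2 - lap_eig N w (N - k + 1)) / 2 \<le> 1 - dual_cheeger N w k \<and>
         1 - dual_cheeger N w k \<le> C * real k ^ 3 * sqrt (2 - lap_eig N w (N - k + 1)))"
proof (intro exI[of _ 30] conjI allI impI; (elim conjE)?)
  fix N w k assume G: "wgraph N w" and k: "1 \<le> k" "k \<le> N"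
  have "signless N w u v = signless N w v u" if "u < N" "v < N" for u v
    using G that unfolding wgraph_def signless_def by auto
  then obtain g \<eta> where orth: "\<forall>i<N. \<forall>j<N. wip N (deg N w) (g i) (g j) = (if i = j then 1 else 0)"
    and eig: "\<forall>i<N. \<forall>h. bform N (signless N w) h (g i) = \<eta> i * wip N (deg N w) h (g i)"
    and min: "\<forall>i<N. \<forall>f. (\<forall>j<i. wip N (deg N w) f (g j) = 0) \<longrightarrow>
      \<eta> i * wip N (deg N w) f f \<le> bform N (signless N w) f f"
    and mono: "\<forall>j<N. \<forall>i\<le>j. \<eta> i \<le> \<eta> j"
    using simultaneous_diagonalization[of N "signless N w" "deg N w"] deg_pos[OF G] by blast
  have eta: "2 - lap_eig N w (N - k + 1) = \<eta> (k - 1)"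
    using lap_eig_eq[OF G orth eig mono k] by simp
  obtain S where S: "sub_bipartition N k S"
    "\<forall>i<k. dual_cheeger N w k \<le> bip_ratio N w (S (2*i)) (S (2*i+1))"
    using dual_cheeger_attained[OF k] by blast
  have "\<forall>f. (\<forall>j<k-1. wip N (deg N w) f (g j) = 0) \<longrightarrow>
      \<eta> (k - 1) * wip N (deg N w) f f \<le> bform N (signless N w) f f"
    using min k by simp
  from signless_eigenvalue_le[OF G k(1) S(1) this S(2)[rule_format]]
  show "(2 - lap_eig N w (N - k + 1)) / 2 \<le> 1 - dual_cheeger N w k" unfolding eta by simp
  \<comment> \<open>The first \<open>k\<close> eigenfunctions, numbered from 0, each have energy at
    most the last eigenvalue among them.\<close>
  interpret spectral_embedding N w k g "\<eta> (k - 1)"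
  proof
    show "wip N (deg N w) (g i) (g j) = (if i = j then 1 else 0)" if "i < k" "j < k" for i j
      using orth that k by simp
    show "bform N (signless N w) (g j) (g j) \<le> \<eta> (k - 1)" if "j < k" for j
    proof -
      have "bform N (signless N w) (g j) (g j) = \<eta> j" using eig orth that k by simp
      also have "\<dots> \<le> \<eta> (k - 1)" using mono that k by simp
      finally show ?thesis .
    qed
  qed (use G k in auto)
  show "1 - dual_cheeger N w k \<le> 30 * real k ^ 3 * sqrt (2 - lap_eig N w (N - k + 1))"
    unfolding eta
  \<comment> \<open>The bipartition is only available for \<open>\<rho>\<close> strictly above the
    bound, as \<open>threshold_pair\<close> needs a strict inequality; letting \<open>\<rho>\<close>
    decrease to the bound also covers eigenvalue 0.\<close>
  proof (rule dense_ge)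
    fix \<rho> assume "30 * real k ^ 3 * sqrt (\<eta> (k - 1)) < \<rho>"
    then obtain S where S: "sub_bipartition N k S"
      "\<forall>i<k. 1 - \<rho> \<le> bip_ratio N w (S (2*i)) (S (2*i+1))"
      using sub_bipartition_exists by blast
    then have "1 - \<rho> \<le> dual_cheeger N w k"
      by (intro dual_cheeger_ge[OF k(1) S(1)]) simp
    then show "1 - dual_cheeger N w k \<le> \<rho>" by simp
  qed
qed simp

end
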